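(* Let $\alpha,\beta,\gamma,\delta,\eta\in\mathbb{C}$ with $\Re(\alpha)>0$, $\Re(\beta)>0$, $\Re(\gamma)>0$. Then the trivariate Mittag-Leffler function (with $u,v,w\in\mathbb{C}$) has the following integral representation on the complex plane: $$E_{\alpha,\beta,\gamma,\delta}^{\eta}(u,v,w)=\frac{1}{2\pi i}\int_{H}\frac{e^{\tau}\tau^{-\delta}}{\left(1-u\tau^{-\alpha}-v\tau^{-\beta}-w\tau^{-\gamma}\right)^{\eta}}\,d\tau,$$ where $H$ is the Hankel contour.
   Context: The trivariate Mittag-Leffler function is $$E_{\alpha,\beta,\gamma,\delta}^{\eta}(u,v,w)=\sum_{l=0}^{\infty}\sum_{p=0}^{\infty}\sum_{k=0}^{\infty}\frac{(\eta)_{l+p+k}}{\Gamma(l\alpha+p\beta+k\gamma+\delta)}\frac{u^l v^p w^k}{l!\,p!\,k!},$$ for $\alpha,\beta,\gamma,\delta,\eta\in\mathbb{C}$ with $\Re(\alpha),\Re(\beta),\Re(\gamma)>0$ and $u,v,w\in\mathbb{C}$. Here $(\eta)_n$ is the Pochhammer symbol, $(\eta)_0=1$, $(\eta)_n=\eta(\eta+1)\cdots(\eta+n-1)$ for $n\ge 1$, and $1/\Gamma$ is the reciprocal Gamma function (zero at the poles of $\Gamma$). The Hankel contour is the standard contour that starts at $-\infty$ below the negative real axis, encircles the origin once counterclockwise, and returns to $-\infty$ above the negative real axis, as in Hankel's formula $\frac{1}{\Gamma(s)}=\frac{1}{2\pi i}\int_H \tau^{-s}e^{\tau}\,d\tau$,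 $s\in\mathbb{C}$.
   Formalization: The Hankel contour H is required to be wide enough that |uτ^{-α}+vτ^{-β}+wτ^{-γ}|<1 along it; for an arbitrary H the formula fails (α=δ=η=1, v=w=0, u=1: E=e, but the integral is 0 if H passes between 0 and 1). *)

theory Defs
  imports "HOL-Complex_Analysis.Complex_Analysis" "HOL-Real_Asymp.Real_Asymp"
begin

definition mittag_leffler3 ::
  "complex \<Rightarrow> complex \<Rightarrow> complex \<Rightarrow> complex \<Rightarrow> complex \<Rightarrow> complex \<Rightarrow> complex \<Rightarrow> complex \<Rightarrow> complex"
where
  "mittag_leffler3 \<alpha> \<beta> \<gamma> \<delta> \<eta> u v w =
     (\<Sum>l. \<Sum>p. \<Sum>k.
        pochhammer \<eta> (l + p + k)
          * rGamma (of_nat l * \<alpha> + of_nat p * \<beta> + of_nat k * \<gamma> + \<delta>)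
          * (u ^ l * v ^ p * w ^ k / (fact l * fact p * fact k)))"

text \<open>
  A Hankel contour is parametrised by the whole real line; \<open>H \<circ> linepath a b\<close> is its piece from
  \<open>H a\<close> to \<open>H b\<close>, reparametrised to the unit interval. Avoiding the closed negative real axis
  and passing from below it to above it, the contour encircles the origin once counterclockwise.
  The bound on the imaginary part says that the two ends go to infinity within a sector around
  the negative real axis with half-angle less than \<open>\<pi>/2\<close>, so that the exponential decays
  along them; ends parallel to the axis and ends along rays are both allowed.
\<close>

definition hankel_contour :: "(real \<Rightarrow> complex) \<Rightarrow> bool" where
  "hankel_contour H \<longleftrightarrow>
     (\<forall>a b. valid_path (H \<circ> linepath a b)) \<and>
     (\<forall>t. H t \<notin> \<real>\<^sub>\<le>\<^sub>0) \<and>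
     filterlim (\<lambda>t. Re (H t)) at_bot at_bot \<and> (\<forall>\<^sub>F t in at_bot. Im (H t) < 0) \<and>
     filterlim (\<lambda>t. Re (H t)) at_bot at_top \<and> (\<forall>\<^sub>F t in at_top. Im (H t) > 0) \<and>
     (\<exists>C. \<forall>t. \<bar>Im (H t)\<bar> \<le> C * (1 + \<bar>Re (H t)\<bar>))"

definition has_hankel_integral ::
  "(complex \<Rightarrow> complex) \<Rightarrow> complex \<Rightarrow> (real \<Rightarrow> complex) \<Rightarrow> bool"
where
  "has_hankel_integral f I H \<longleftrightarrow>
     (\<forall>a b. f contour_integrable_on (H \<circ> linepath a b)) \<and>
     ((\<lambda>(a, b). contour_integral (H \<circ> linepath a b) f) \<longlongrightarrow> I) (at_bot \<times>\<^sub>F at_top)"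

definition hankel_integrable :: "(complex \<Rightarrow> complex) \<Rightarrow> (real \<Rightarrow> complex) \<Rightarrow> bool" where
  "hankel_integrable f H \<longleftrightarrow> (\<exists>I. has_hankel_integral f I H)"

definition hankel_integral :: "(real \<Rightarrow> complex) \<Rightarrow> (complex \<Rightarrow> complex) \<Rightarrow> complex" where
  "hankel_integral H f = (THE I. has_hankel_integral f I H)"

lemma hankel_integral_unique:
  assumes "has_hankel_integral f I H"
  shows "hankel_integral H f = I"
  unfolding hankel_integral_def
proof (rule the_equality)
  fix J assume "has_hankel_integral f J H"
  moreover have "(at_bot \<times>\<^sub>F at_top :: (real \<times> real) filter) \<noteq> bot"
    by (simp add: prod_filter_eq_bot)
  ultimately show "J = I"
    using assms tendsto_unique unfolding has_hankel_integral_def by blast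
qed (fact assms)

text \<open>
  The integral representation needs a contour wide enough for the singularities of
  \<open>(1 - u \<tau>\<^sup>-\<^sup>\<alpha> - v \<tau>\<^sup>-\<^sup>\<beta> - w \<tau>\<^sup>-\<^sup>\<gamma>)\<^sup>-\<^sup>\<eta>\<close> to lie inside it. The standard way to
  ensure this is to require \<open>\<bar>u \<tau>\<^sup>-\<^sup>\<alpha> + v \<tau>\<^sup>-\<^sup>\<beta> + w \<tau>\<^sup>-\<^sup>\<gamma>\<bar> < 1\<close> along the contour, where the
  binomial series converges. This holds for every contour that stays far enough from the
  origin, and there are Hankel contours arbitrarily far from the origin.
\<close>

lemma tendsto_mult_powr_uminus:
  fixes a u :: complex
  assumes "Re a > 0"
  shows "((\<lambda>\<tau>. u * \<tau> powr (- a)) \<longlongrightarrow> 0) at_infinity"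
proof (rule Lim_null_comparison)
  show "\<forall>\<^sub>F \<tau> in at_infinity. norm (u * \<tau> powr (- a))
          \<le> norm u * exp (pi * \<bar>Im a\<bar>) * norm \<tau> powr (- Re a)"
  proof (rule eventually_at_infinityI[of 1])
    fix \<tau> :: complex assume t: "1 \<le> norm \<tau>"
    hence nz: "\<tau> \<noteq> 0" by auto
    have "Im a * Im (Ln \<tau>) \<le> \<bar>Im a\<bar> * \<bar>Im (Ln \<tau>)\<bar>"
      by (metis abs_ge_self abs_mult)
    also have "\<dots> \<le> \<bar>Im a\<bar> * pi"
      using mpi_less_Im_Ln[OF nz] Im_Ln_le_pi[OF nz] by (intro mult_left_mono) auto
    finally have "Im a * Im (Ln \<tau>) \<le> pi * \<bar>Im a\<bar>" by (simp add: mult.commute)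
    hence "norm (\<tau> powr (- a)) \<le> exp (pi * \<bar>Im a\<bar>) * norm \<tau> powr (- Re a)"
      using nz by (simp add: powr_def norm_exp_eq_Re flip: exp_add)
    thus "norm (u * \<tau> powr (- a))
            \<le> norm u * exp (pi * \<bar>Im a\<bar>) * norm \<tau> powr (- Re a)"
      by (simp add: norm_mult mult_left_mono mult.assoc)
  qed
  have "((\<lambda>\<tau>::complex. norm \<tau> powr (- Re a)) \<longlongrightarrow> 0) at_infinity"
    using assms by (intro tendsto_neg_powr filterlim_norm_at_top) auto
  from tendsto_mult_right_zero[OF this]
  show "((\<lambda>\<tau>::complex. norm u * exp (pi * \<bar>Im a\<bar>) * norm \<tau> powr (- Re a)) \<longlongrightarrow> 0) at_infinity" .
qed

lemma norm_less_1_far: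
  fixes \<alpha> \<beta> \<gamma> u v w :: complex
  assumes "Re \<alpha> > 0" "Re \<beta> > 0" "Re \<gamma> > 0"
  shows "\<exists>R>0. \<forall>\<tau>. R \<le> norm \<tau> \<longrightarrow>
           norm (u * \<tau> powr (- \<alpha>) + v * \<tau> powr (- \<beta>) + w * \<tau> powr (- \<gamma>)) < 1"
proof -
  have "((\<lambda>\<tau>. u * \<tau> powr (- \<alpha>) + v * \<tau> powr (- \<beta>) + w * \<tau> powr (- \<gamma>)) \<longlongrightarrow> 0 + 0 + 0)
          at_infinity"
    using assms by (intro tendsto_add tendsto_mult_powr_uminus)
  hence "\<forall>\<^sub>F \<tau> in at_infinity.
           norm (u * \<tau> powr (- \<alpha>) + v * \<tau> powr (- \<beta>) + w * \<tau> powr (- \<gamma>)) < 1"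
    by (auto simp: tendsto_iff dist_norm dest: spec[of _ 1])
  thus ?thesis by (simp add: eventually_at_infinity_pos)
qed

lemma hankel_contour_exists:
  assumes "R > 0"
  shows "\<exists>H. hankel_contour H \<and> (\<forall>t. R \<le> norm (H t))"
proof -
  define c where "c = R\<^sup>2 + 1"
  define H where "H = (\<lambda>t. Complex (c - t\<^sup>2) t)"
  have c: "c > 0" using zero_le_power2[of R] by (simp add: c_def add_nonneg_pos)
  have Heq: "H = (\<lambda>t. of_real (c - t\<^sup>2) + \<i> * of_real t)"
    by (auto simp: H_def complex_eq_iff)
  have "valid_path (H \<circ> linepath a b)" for a b
    unfolding valid_path_def
    by (intro C1_differentiable_imp_piecewise)
       (auto simp: Heq o_def linepath_def power2_eq_square
             intro!: derivative_intros)
  moreover have "H t \<notin> \<real>\<^sub>\<le>\<^sub>0" for t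
    using c by (auto simp: H_def complex_nonpos_Reals_iff)
  moreover have "filterlim (\<lambda>t. Re (H t)) at_bot at_bot" "filterlim (\<lambda>t. Re (H t)) at_bot at_top"
    unfolding H_def complex.sel by real_asymp+
  moreover have "\<forall>\<^sub>F t in at_bot. Im (H t) < 0" "\<forall>\<^sub>F t in at_top. Im (H t) > 0"
    unfolding H_def complex.sel by real_asymp+
  moreover have "\<bar>Im (H t)\<bar> \<le> (1 + c) * (1 + \<bar>Re (H t)\<bar>)" for t
  proof -
    have "\<bar>t\<bar> \<le> 1 + t\<^sup>2"
      using zero_le_power2[of "\<bar>t\<bar> - 1"] by (simp add: power2_diff)
    also have "\<dots> \<le> 1 + c + \<bar>c - t\<^sup>2\<bar>" by linarith
    also have "\<dots> \<le> 1 + c + \<bar>c - t\<^sup>2\<bar> + c * \<bar>c - t\<^sup>2\<bar>"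
      using c by simp
    also have "\<dots> = (1 + c) * (1 + \<bar>c - t\<^sup>2\<bar>)"
      by (simp only: distrib_left distrib_right mult_1 mult_1_right add_ac)
    finally show ?thesis by (simp add: H_def)
  qed
  moreover have "R \<le> norm (H t)" for t
  proof -
    have "R\<^sup>2 \<le> c\<^sup>2 - 2 * c * t\<^sup>2 + (t\<^sup>2)\<^sup>2 + t\<^sup>2"
    proof -
      have "c\<^sup>2 - 2 * c * t\<^sup>2 + (t\<^sup>2)\<^sup>2 + t\<^sup>2 = (t\<^sup>2 - c + 1/2)\<^sup>2 + c - 1/4"
        by (simp add: power2_eq_square algebra_simps)
      moreover have "0 \<le> (t\<^sup>2 - c + 1/2)\<^sup>2" by (rule zero_le_power2)
      moreover have "c = R\<^sup>2 + 1" by (rule c_def)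
      ultimately show ?thesis by linarith
    qed
    hence "R\<^sup>2 \<le> (norm (H t))\<^sup>2" by (simp add: H_def cmod_power2 power2_diff)
    thus ?thesis by (rule power2_le_imp_le) simp
  qed
  ultimately show ?thesis unfolding hankel_contour_def by blast
qed

end

theory Submission
  imports Defs
begin

text \<open>
  Hankel's formula \<open>1/\<Gamma>(s) = 1/(2\<pi>\<i>) \<integral> \<tau>\<^sup>-\<^sup>s e\<^sup>\<tau> d\<tau>\<close> holds on every Hankel contour: the integrand has a primitive
  on the slit plane, so only the limit of that primitive at the two ends matters. For \<open>Re s < 0\<close> the
  limit is found by collapsing onto the two sides of the slit, which gives Euler's integral for
  \<open>\<Gamma>(1 - s)\<close> and then the reflection formula; integration by parts moves the result from \<open>s\<close> to
  \<open>s + 1\<close>, with \<open>s = 1\<close> read off the logarithm.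

  With \<open>S = u \<tau>\<^sup>-\<^sup>\<alpha> + v \<tau>\<^sup>-\<^sup>\<beta> + w \<tau>\<^sup>-\<^sup>\<gamma>\<close>, expand \<open>(1 - S)\<^sup>-\<^sup>\<eta> = \<Sum> (\<eta>)\<^sub>n S\<^sup>n / n!\<close> and integrate termwise. The
  convergence is uniform on compact pieces of the contour. The ends may wander, so they are controlled
  by path independence instead: near infinity every term is holomorphic on convex regions and
  bounded by a summable multiple of \<open>e\<close> to the power \<open>Re \<tau> / 2\<close>. On the given contour the sum of the moduli of
  the three parts of \<open>S\<close> may exceed \<open>1\<close>, so the integral only yields the sum over the diagonals
  \<open>l + p + k = n\<close>; absolute convergence of the triple series comes from the growth of \<open>1/\<Gamma>\<close>, which
  Hankel's formula on a contour far from the origin provides.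
\<close>

section \<open>Tails of Hankel contours\<close>

text \<open>The sign \<open>\<sigma> = \<plusminus>1\<close> selects the upper or the lower end of the contour.\<close>

definition hankel_tail :: "real \<Rightarrow> real \<Rightarrow> real \<Rightarrow> complex set" where
  "hankel_tail \<sigma> c X = {z. Re z < - X \<and> 0 < \<sigma> * Im z \<and> \<sigma> * Im z < c * (- Re z)}"

lemma open_hankel_tail: "open (hankel_tail \<sigma> c X)"
  unfolding hankel_tail_def by (intro open_Collect_conj open_Collect_less continuous_intros)

text \<open>A tail is cut out by three strict real-affine inequalities, so it is an intersection of
  open half-planes.\<close>

lemma convex_hankel_tail: "convex (hankel_tail \<sigma> c X)"
proof (rule convexI)
  fix x y u v
  assume *: "x \<in> hankel_tail \<sigma> c X" "y \<in> hankel_tail \<sigma> c X" "0 \<le> u" "0 \<le> v" "u + v = (1::real)"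
  have A: "u * a + v * b < d" if "a < d" "b < d" for a b d
    using convex_bound_lt[OF that *(3-5)] .
  have "u * Re x + v * Re y < - X"
    using * by (intro A) (auto simp: hankel_tail_def)
  moreover have "u * (- (\<sigma> * Im x)) + v * (- (\<sigma> * Im y)) < 0"
    using * by (intro A) (auto simp: hankel_tail_def)
  moreover have "u * (\<sigma> * Im x + c * Re x) + v * (\<sigma> * Im y + c * Re y) < 0"
    using * by (intro A) (auto simp: hankel_tail_def)
  ultimately show "u *\<^sub>R x + v *\<^sub>R y \<in> hankel_tail \<sigma> c X"
    by (simp add: hankel_tail_def algebra_simps)
qed

lemma hankel_tail_mono: "X \<le> Y \<Longrightarrow> hankel_tail \<sigma> c Y \<subseteq> hankel_tail \<sigma> c X"
  by (auto simp: hankel_tail_def)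

lemma hankel_tail_not_nonpos_Reals: "z \<in> hankel_tail \<sigma> c X \<Longrightarrow> z \<notin> \<real>\<^sub>\<le>\<^sub>0"
  by (auto simp: hankel_tail_def complex_nonpos_Reals_iff)

text \<open>Half of the decay absorbs the linear factor, which arises as the length of a vertical
  segment across a tail.\<close>

lemma mult_exp_half_le:
  fixes x :: real
  shows "x * exp (- x / 2) \<le> 4 * exp (- x / 4)"
proof -
  have "x / 4 \<le> exp (x / 4)" using exp_ge_add_one_self[of "x/4"] by linarith
  hence "x / 4 * exp (- x / 2) \<le> exp (x / 4) * exp (- x / 2)" by (intro mult_right_mono) auto
  also have "\<dots> = exp (- x / 4)" by (simp flip: exp_add)
  finally show ?thesis by simp
qed

text \<open>The two points are joined by a horizontal segment going left followed by a vertical one.\<close>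

lemma hankel_tail_primitive_bound:
  assumes P: "\<And>z. z \<in> hankel_tail \<sigma> c X \<Longrightarrow> (P has_field_derivative f z) (at z)"
    and f: "\<And>z. z \<in> hankel_tail \<sigma> c X \<Longrightarrow> norm (f z) \<le> K * exp (Re z / 2)"
    and z: "z \<in> hankel_tail \<sigma> c Y" "z' \<in> hankel_tail \<sigma> c Y" and \<sigma>: "\<bar>\<sigma>\<bar> = 1" and Y: "0 \<le> X" "X \<le> Y"
  shows "norm (P z - P z') \<le> K * (2 + 4 * c) * exp (- Y / 4)"
proof -
  have T: "w \<in> hankel_tail \<sigma> c X" if "w \<in> hankel_tail \<sigma> c Y" for w
    using that Y by (auto simp: hankel_tail_def)
  have K: "K \<ge> 0"
  proof -
    have "0 \<le> K * exp (Re z / 2)" using f[OF T[OF z(1)]] by (meson norm_ge_zero order_trans)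
    thus ?thesis by (simp add: zero_le_mult_iff)
  qed
  have c: "c > 0"
    using z(1) Y by (auto simp: hankel_tail_def) (smt (verit) mult_nonpos_nonpos)
  \<comment> \<open>The claim is symmetric in the two points, so \<open>z'\<close> may be taken as
    the one further left.\<close>
  have *: "norm (P z - P z') \<le> K * (2 + 4 * c) * exp (- Y / 4)"
    if z: "z \<in> hankel_tail \<sigma> c Y" "z' \<in> hankel_tail \<sigma> c Y" and le: "Re z' \<le> Re z" for z z'
  proof -
    \<comment> \<open>The corner of the path. Moving left from \<open>z\<close> keeps the height
      while the sector widens, so \<open>w\<close> stays in the tail.\<close>
    define w where "w = Complex (Re z') (Im z)"
    have zw: "closed_segment z' w \<subseteq> hankel_tail \<sigma> c Y"
    proof -
      have "c * Re z' \<le> c * Re z" using le c by simp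
      hence "w \<in> hankel_tail \<sigma> c Y" using z by (auto simp: hankel_tail_def w_def)
      thus ?thesis using z convex_hankel_tail by (simp add: closed_segment_subset)
    qed
    have dist: "norm (z' - w) \<le> c * (- Re z')"
    proof -
      have "norm (z' - w) = \<bar>\<sigma> * Im z' - \<sigma> * Im z\<bar>"
        using \<sigma> by (simp add: w_def cmod_def flip: right_diff_distrib abs_mult) (simp add: abs_mult)
      also have "\<dots> \<le> c * (- Re z')"
      proof -
        have "c * Re z' \<le> c * Re z" using le c by simp
        moreover have "0 < \<sigma> * Im z" "\<sigma> * Im z < - (c * Re z)" "0 < \<sigma> * Im z'" "\<sigma> * Im z' < - (c * Re z')"
          using z by (auto simp: hankel_tail_def)
        ultimately show ?thesis unfolding mult_minus_right by linarith
      qed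
      finally show ?thesis .
    qed
    have "norm (P z' - P w) \<le> K * exp (Re z' / 2) * norm (z' - w)"
    proof (rule field_differentiable_bound[where S = "closed_segment z' w" and f' = f])
      fix y assume y: "y \<in> closed_segment z' w"
      hence y': "y \<in> hankel_tail \<sigma> c X" using zw T by auto
      show "(P has_field_derivative f y) (at y within closed_segment z' w)"
        using P[OF y'] has_field_derivative_at_within by blast
      obtain u where "y = (1 - u) *\<^sub>R z' + u *\<^sub>R w" using y by (auto simp: in_segment)
      hence "Re y = (1 - u) * Re z' + u * Re z'" by (simp add: w_def)
      hence "Re y = Re z'" by (simp add: algebra_simps)
      thus "norm (f y) \<le> K * exp (Re z' / 2)" using f[OF y'] by simp
    qed auto
    also have "\<dots> \<le> K * exp (Re z' / 2) * (c * (- Re z'))"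
      using dist K by (intro mult_left_mono) auto
    also have "\<dots> \<le> K * c * (4 * exp (Re z' / 4))"
      using mult_left_mono[OF mult_exp_half_le[of "- Re z'"], of "K * c"] K c
      by (simp add: algebra_simps)
    also have "\<dots> \<le> K * c * (4 * exp (- Y / 4))"
      using z K c by (intro mult_left_mono) (auto simp: hankel_tail_def)
    finally have 1: "norm (P z' - P w) \<le> K * (4 * c) * exp (- Y / 4)"
      using K by (simp add: mult_left_mono algebra_simps)
    have 2: "norm (P w - P z) \<le> 2 * K * exp (Re z / 2)"
    proof (cases "Re z' = Re z")
      case True
      hence "w = z" by (simp add: w_def complex_eq_iff)
      thus ?thesis using K by simp
    next
      case False
      define d where "d = Re z - Re z'"
      have d: "d > 0" using le False by (simp add: d_def)
      define p where "p = (\<lambda>r. P (z - of_real r))"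
      have in_tail: "z - of_real r \<in> hankel_tail \<sigma> c X" if "0 \<le> r" for r
      proof -
        have "0 \<le> c * r" using c that by simp
        moreover have "0 < \<sigma> * Im z" "\<sigma> * Im z < - (c * Re z)" "Re z < - X"
          using T[OF z(1)] by (auto simp: hankel_tail_def)
        moreover have "c * (- (Re z - r)) = c * r - c * Re z" by (simp add: algebra_simps)
        ultimately show ?thesis using that unfolding hankel_tail_def mem_Collect_eq by simp
      qed
      have p: "(p has_vector_derivative - f (z - of_real r)) (at r)" if "0 \<le> r" for r
      proof -
        have "((\<lambda>r::real. z - of_real r) has_vector_derivative (0 - 1)) (at r)"
          by (auto intro!: derivative_eq_intros)
        from field_vector_diff_chain_at[OF this P[OF in_tail[OF that]]]
        show ?thesis by (simp add: p_def o_def)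
      qed
      \<comment> \<open>A maximum of the bound times \<open>d\<close> would grow with
        \<open>d\<close>. Comparison with a primitive of the exponential bound gives an estimate
        independent of \<open>d\<close>.\<close>
      have "norm (p d - p 0) \<le> (- 2 * K * exp ((Re z - d) / 2)) - (- 2 * K * exp ((Re z - 0) / 2))"
      proof (rule differentiable_bound_general[OF d])
        show "continuous_on {0..d} p"
          by (rule continuous_on_vector_derivative, rule has_vector_derivative_at_within[OF p]) auto
        show "continuous_on {0..d} (\<lambda>r. - 2 * K * exp ((Re z - r) / 2))"
          by (intro continuous_intros) auto
        show "(p has_vector_derivative - f (z - of_real r)) (at r)" if "0 < r" for r
          using p that by simp
        show "((\<lambda>r. - 2 * K * exp ((Re z - r) / 2)) has_vector_derivative
                 K * exp ((Re z - r) / 2)) (at r)" for r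
          unfolding has_real_derivative_iff_has_vector_derivative[symmetric]
          by (auto intro!: derivative_eq_intros)
        show "norm (- f (z - of_real r)) \<le> K * exp ((Re z - r) / 2)" if "0 < r" for r
          using f[OF in_tail[of r]] that by simp
      qed
      also have "\<dots> \<le> 2 * K * exp (Re z / 2)" using K by simp
      also have "p d = P w"
      proof -
        have "z - of_real d = w" by (simp add: d_def w_def complex_eq_iff)
        thus ?thesis by (simp add: p_def)
      qed
      finally show ?thesis by (simp add: p_def)
    qed
    also have "\<dots> \<le> 2 * K * exp (- Y / 4)"
      using z K Y by (intro mult_left_mono) (auto simp: hankel_tail_def)
    finally have "norm (P w - P z) \<le> 2 * K * exp (- Y / 4)" .
    with 1 have "norm (P z' - P w) + norm (P w - P z) \<le> K * (2 + 4 * c) * exp (- Y / 4)"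
      by (simp add: algebra_simps)
    thus ?thesis
      using norm_triangle_ineq[of "P z' - P w" "P w - P z"] by (simp add: norm_minus_commute)
  qed
  show ?thesis
    using *[OF z] *[OF z(2,1)] by (cases "Re z' \<le> Re z") (auto simp: norm_minus_commute)
qed

text \<open>The parameters may come in any order. All three pieces are subpaths of one path over an
  interval containing \<open>a\<close>, \<open>b\<close> and \<open>d\<close>, and subpath integrals
  are additive.\<close>

lemma contour_integral_pieces_combine:
  fixes H :: "real \<Rightarrow> complex" and a b d :: real
  assumes "\<And>a b. valid_path (H \<circ> linepath a b)"
    and "\<And>a b. f contour_integrable_on (H \<circ> linepath a b)"
  shows "contour_integral (H \<circ> linepath a b) f + contour_integral (H \<circ> linepath b d) f =
           contour_integral (H \<circ> linepath a d) f"
proof -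
  define A where "A = min a (min b d)"
  \<comment> \<open>Adding \<open>1\<close> keeps the interval nondegenerate even if
    \<open>a = b = d\<close>; the rescaling \<open>r\<close> divides by
    \<open>B - A\<close>.\<close>
  define B where "B = max a (max b d) + 1"
  have AB: "A < B" by (simp add: A_def B_def)
  define r where "r = (\<lambda>x. (x - A) / (B - A))"
  have r: "r x \<in> {0..1}" if "x \<in> {a, b, d}" for x
    using AB that unfolding r_def by (auto simp: A_def B_def field_simps)
  have *: "subpath (r x) (r y) (H \<circ> linepath A B) = H \<circ> linepath x y" for x y
  proof
    fix t
    have rr: "r x * (B - A) = x - A" for x using AB by (simp add: r_def)
    have "((r y - r x) * t + r x) * (B - A) = (r y * (B - A) - r x * (B - A)) * t + r x * (B - A)"
      by (simp add: algebra_simps)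
    also have "\<dots> = (1 - t) * (x - A) + t * (y - A)"
      by (simp only: rr) (simp add: algebra_simps)
    finally have "((r y - r x) * t + r x) * (B - A) = (1 - t) * (x - A) + t * (y - A)" .
    hence "linepath A B ((r y - r x) * t + r x) = linepath x y t"
      by (simp add: linepath_def algebra_simps)
    thus "subpath (r x) (r y) (H \<circ> linepath A B) t = (H \<circ> linepath x y) t"
      by (simp add: subpath_def)
  qed
  show ?thesis
    using contour_integral_subpath_combine[OF assms(2) assms(1) r r r, of a b d A B] by (simp add: *)
qed

section \<open>Ends of a contour in the tails, and truncation errors\<close>

lemma path_image_comp_linepath: "path_image (H \<circ> linepath a b) = H ` closed_segment a b"
  unfolding path_image_compose path_image_linepath ..

text \<open>The whole ends beyond \<open>a\<close> and \<open>b\<close> have to lie in the tails,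
  not just two points, because the estimates integrate over pieces of these ends.\<close>

definition ends_in_hankel_tails :: "(real \<Rightarrow> complex) \<Rightarrow> real \<Rightarrow> real \<Rightarrow> real \<Rightarrow> real \<Rightarrow> bool" where
  "ends_in_hankel_tails H c Y a b \<longleftrightarrow>
     (\<forall>t\<le>a. H t \<in> hankel_tail (-1) c Y) \<and> (\<forall>t\<ge>b. H t \<in> hankel_tail 1 c Y)"

text \<open>One slope \<open>c\<close> serves every depth \<open>Y\<close>, so the constants of the
  later estimates do not depend on \<open>Y\<close>.\<close>

lemma hankel_contour_ends_in_tails:
  assumes "hankel_contour H"
  obtains c where "c > 0"
    and "\<And>Y. \<forall>\<^sub>F (a, b) in at_bot \<times>\<^sub>F at_top. ends_in_hankel_tails H c Y a b"
proof -
  from assms obtain C where C: "\<And>t. \<bar>Im (H t)\<bar> \<le> C * (1 + \<bar>Re (H t)\<bar>)"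
    unfolding hankel_contour_def by blast
  \<comment> \<open>Left of real part \<open>-1\<close> the sector bound is at most
    \<open>2 * \<bar>C\<bar>\<close> times the distance to the imaginary axis; the extra
    \<open>1\<close> makes the inequality strict.\<close>
  define c where "c = 2 * \<bar>C\<bar> + 1"
  have Im_less: "\<bar>Im (H t)\<bar> < c * (- Re (H t))" if "Re (H t) < - 1" for t
  proof -
    have "\<bar>Im (H t)\<bar> \<le> \<bar>C\<bar> * (1 + \<bar>Re (H t)\<bar>)"
      using C[of t] by (smt (verit) mult_right_mono)
    also have "\<dots> \<le> \<bar>C\<bar> * (2 * (- Re (H t)))"
      using that by (intro mult_left_mono) auto
    also have "\<dots> < c * (- Re (H t))"
      using that by (simp add: c_def algebra_simps)
    finally show ?thesis .
  qed
  have "\<forall>\<^sub>F (a, b) in at_bot \<times>\<^sub>F at_top. ends_in_hankel_tails H c Y a b" for Y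
  proof -
    have "\<forall>\<^sub>F t in at_bot. Re (H t) < - max Y 1 \<and> Im (H t) < 0"
      using assms unfolding hankel_contour_def filterlim_at_bot_dense
      by (intro eventually_conj) blast+
    then obtain A where A: "\<And>t. t \<le> A \<Longrightarrow> Re (H t) < - max Y 1 \<and> Im (H t) < 0"
      unfolding eventually_at_bot_linorder by blast
    have "\<forall>\<^sub>F t in at_top. Re (H t) < - max Y 1 \<and> Im (H t) > 0"
      using assms unfolding hankel_contour_def filterlim_at_bot_dense
      by (intro eventually_conj) blast+
    then obtain B where B: "\<And>t. t \<ge> B \<Longrightarrow> Re (H t) < - max Y 1 \<and> Im (H t) > 0"
      unfolding eventually_at_top_linorder by blast
    have "H t \<in> hankel_tail (-1) c Y" if "t \<le> A" for t
      using A[OF that] Im_less[of t] by (auto simp: hankel_tail_def)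
    moreover have "H t \<in> hankel_tail 1 c Y" if "t \<ge> B" for t
      using B[OF that] Im_less[of t] by (auto simp: hankel_tail_def)
    ultimately have "ends_in_hankel_tails H c Y a b" if "a \<le> A" "b \<ge> B" for a b
      using that unfolding ends_in_hankel_tails_def by fastforce
    moreover have "\<forall>\<^sub>F p in at_bot \<times>\<^sub>F at_top. fst p \<le> A \<and> snd p \<ge> B"
      by (intro eventually_prodI eventually_le_at_bot eventually_ge_at_top)
    ultimately show ?thesis by (auto elim: eventually_mono)
  qed
  moreover have "c > 0" by (simp add: c_def)
  ultimately show ?thesis using that by blast
qed

lemma tendsto_exp_bound:
  fixes \<phi> :: "'a \<Rightarrow> complex"
  assumes "\<And>Y. Y \<ge> X \<Longrightarrow> \<forall>\<^sub>F p in F. norm (\<phi> p - I) \<le> M * exp (- Y / 4)"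
  shows "(\<phi> \<longlongrightarrow> I) F"
proof (rule tendstoI)
  fix e :: real assume e: "e > 0"
  have "((\<lambda>Y. M * exp (- Y / 4)) \<longlongrightarrow> 0) at_top"
    by real_asymp
  hence "\<forall>\<^sub>F Y in at_top. M * exp (- Y / 4) < e"
    using e by (simp add: order_tendsto_iff)
  hence "\<forall>\<^sub>F Y in at_top. Y \<ge> X \<and> M * exp (- Y / 4) < e"
    by (intro eventually_conj eventually_ge_at_top)
  then obtain Y where "Y \<ge> X" "M * exp (- Y / 4) < e"
    unfolding eventually_at_top_linorder by blast
  thus "\<forall>\<^sub>F p in F. dist (\<phi> p) I < e"
    using assms[of Y] by (auto elim!: eventually_mono simp: dist_norm)
qed

text \<open>A primitive on the convex tail makes the integral depend only on the endpoints. Hence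
  the bound ignores the length of \<open>g\<close>, which may wander.\<close>

lemma contour_integral_hankel_tail_bound:
  assumes "valid_path g" "path_image g \<subseteq> hankel_tail \<sigma> c Y"
    and hol: "f holomorphic_on hankel_tail \<sigma> c X"
    and f: "\<And>z. z \<in> hankel_tail \<sigma> c X \<Longrightarrow> norm (f z) \<le> K * exp (Re z / 2)"
    and "\<bar>\<sigma>\<bar> = 1" "0 \<le> X" "X \<le> Y"
  shows "norm (contour_integral g f) \<le> K * (2 + 4 * c) * exp (- Y / 4)"
proof -
  let ?T = "hankel_tail \<sigma> c X"
  obtain P where P: "\<And>z. z \<in> ?T \<Longrightarrow> (P has_field_derivative f z) (at z within ?T)"
    using holomorphic_convex_primitive'[OF convex_hankel_tail open_hankel_tail hol] by blast
  have sub: "path_image g \<subseteq> ?T" using assms(2) hankel_tail_mono[OF assms(7)] by blast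
  have "contour_integral g f = P (pathfinish g) - P (pathstart g)"
    using contour_integral_primitive[OF P assms(1) sub] by (simp add: contour_integral_unique)
  moreover have "(P has_field_derivative f z) (at z)" if "z \<in> ?T" for z
    using P[OF that] at_within_open[OF that open_hankel_tail] by simp
  ultimately show ?thesis
    using hankel_tail_primitive_bound[of \<sigma> c X P f K "pathfinish g" Y "pathstart g"] assms
    by (metis pathfinish_in_path_image pathstart_in_path_image subsetD)
qed

text \<open>Enlarging the piece adds one integral in each tail, whence the factor \<open>2\<close>,
  and the larger pieces tend to \<open>I\<close>. The estimate depends on \<open>f\<close> only
  through \<open>K\<close>, so it can be summed over a series.\<close>

lemma hankel_integral_tail_bound:
  assumes H: "hankel_contour H" and I: "has_hankel_integral f I H"
    and hol: "\<And>\<sigma>. \<bar>\<sigma>\<bar> = 1 \<Longrightarrow> f holomorphic_on hankel_tail \<sigma> c X"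
    and f: "\<And>\<sigma> z. \<bar>\<sigma>\<bar> = 1 \<Longrightarrow> z \<in> hankel_tail \<sigma> c X \<Longrightarrow> norm (f z) \<le> K * exp (Re z / 2)"
    and ends: "ends_in_hankel_tails H c Y a b" and XY: "0 \<le> X" "X \<le> Y"
  shows "norm (contour_integral (H \<circ> linepath a b) f - I) \<le> 2 * K * (2 + 4 * c) * exp (- Y / 4)"
proof -
  let ?J = "\<lambda>a b. contour_integral (H \<circ> linepath a b) f"
  let ?B = "K * (2 + 4 * c) * exp (- Y / 4)"
  have valid: "valid_path (H \<circ> linepath a b)" for a b
    using H by (simp add: hankel_contour_def)
  have integrable: "f contour_integrable_on (H \<circ> linepath a b)" for a b
    using I by (simp add: has_hankel_integral_def)
  have "norm (?J a b - ?J a' b') \<le> 2 * ?B" if "a' \<le> a" "b \<le> b'" for a' b'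
  proof -
    have "norm (?J a' a) \<le> ?B"
      using that ends XY
      by (intro contour_integral_hankel_tail_bound[where \<sigma> = "-1" and X = X] valid hol f)
         (auto simp: path_image_comp_linepath ends_in_hankel_tails_def closed_segment_eq_real_ivl)
    moreover have "norm (?J b b') \<le> ?B"
      using that ends XY
      by (intro contour_integral_hankel_tail_bound[where \<sigma> = 1 and X = X] valid hol f)
         (auto simp: path_image_comp_linepath ends_in_hankel_tails_def closed_segment_eq_real_ivl)
    moreover have "?J a' b' = ?J a' a + (?J a b + ?J b b')"
      by (simp add: contour_integral_pieces_combine valid integrable)
    hence "norm (?J a b - ?J a' b') = norm (?J a' a + ?J b b')"
      by (simp add: norm_minus_commute add_ac)
    ultimately show ?thesis
      using norm_triangle_ineq[of "?J a' a" "?J b b'"] by linarith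
  qed
  moreover have "\<forall>\<^sub>F p in at_bot \<times>\<^sub>F at_top. fst p \<le> a \<and> b \<le> snd p"
    by (intro eventually_prodI eventually_le_at_bot eventually_ge_at_top)
  ultimately have "\<forall>\<^sub>F p in at_bot \<times>\<^sub>F at_top. norm (?J a b - (\<lambda>(a, b). ?J a b) p) \<le> 2 * ?B"
    by (auto elim!: eventually_mono)
  moreover have "((\<lambda>p. norm (?J a b - (\<lambda>(a, b). ?J a b) p)) \<longlongrightarrow> norm (?J a b - I))
                   (at_bot \<times>\<^sub>F at_top)"
    using I by (intro tendsto_intros) (simp add: has_hankel_integral_def)
  ultimately show ?thesis
    by (intro tendsto_upperbound) (auto simp: prod_filter_eq_bot mult.assoc)
qed

text \<open>The ends of the contour are compared with the test points \<open>- n + \<i>\<close> and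
  \<open>- n - \<i>\<close>: within one tail, values of \<open>F\<close> differ by an exponentially
  small amount. The limit is thus the same for all Hankel contours.\<close>

lemma has_hankel_integral_primitive:
  assumes H: "hankel_contour H"
    and F: "\<And>z. z \<notin> \<real>\<^sub>\<le>\<^sub>0 \<Longrightarrow> (F has_field_derivative f z) (at z)"
    and f: "\<And>c. c > 0 \<Longrightarrow> \<exists>X K. 0 \<le> X \<and> (\<forall>\<sigma> z. \<bar>\<sigma>\<bar> = 1 \<longrightarrow> z \<in> hankel_tail \<sigma> c X \<longrightarrow>
              norm (f z) \<le> K * exp (Re z / 2))"
    and lim: "(\<lambda>n. F (- of_nat n + \<i>) - F (- of_nat n - \<i>)) \<longlonglongrightarrow> I"
  shows "has_hankel_integral f I H"
proof -
  let ?S = "- \<real>\<^sub>\<le>\<^sub>0 :: complex set"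
  have contour: "(f has_contour_integral (F (H b) - F (H a))) (H \<circ> linepath a b)" for a b
  proof -
    have "(f has_contour_integral (F (pathfinish (H \<circ> linepath a b)) - F (pathstart (H \<circ> linepath a b))))
            (H \<circ> linepath a b)"
    proof (rule contour_integral_primitive[where S = ?S])
      show "path_image (H \<circ> linepath a b) \<subseteq> ?S"
        using H unfolding path_image_comp_linepath by (auto simp: hankel_contour_def)
      show "valid_path (H \<circ> linepath a b)"
        using H unfolding hankel_contour_def by blast
      show "(F has_field_derivative f z) (at z within ?S)" if "z \<in> ?S" for z
        using that by (intro has_field_derivative_at_within[OF F]) auto
    qed
    thus ?thesis by (simp add: pathfinish_compose pathstart_compose)
  qed
  obtain c where c: "c > 0"
    and ends: "\<And>Y. \<forall>\<^sub>F (a, b) in at_bot \<times>\<^sub>F at_top. ends_in_hankel_tails H c Y a b"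
    using hankel_contour_ends_in_tails[OF H] by blast
  obtain X K where X: "0 \<le> X" and K: "\<And>\<sigma> z. \<bar>\<sigma>\<bar> = 1 \<Longrightarrow> z \<in> hankel_tail \<sigma> c X \<Longrightarrow>
              norm (f z) \<le> K * exp (Re z / 2)"
    using f[OF c] by blast
  define M where "M = 2 * (K * (2 + 4 * c))"
  have bound: "norm ((F (H b) - F (H a)) - I) \<le> M * exp (- Y / 4)"
    if ab: "ends_in_hankel_tails H c Y a b" and Y: "X \<le> Y" for Y a b
  proof (rule tendsto_upperbound)
    show "(\<lambda>n. norm ((F (H b) - F (H a)) - (F (- of_nat n + \<i>) - F (- of_nat n - \<i>))))
            \<longlonglongrightarrow> norm ((F (H b) - F (H a)) - I)"
      by (intro tendsto_intros lim)
    \<comment> \<open>The two lower bounds on \<open>n\<close> put both test points into the tails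
      of depth \<open>Y\<close>.\<close>
    have "\<forall>\<^sub>F n in sequentially. real n > max Y (1 / c)"
      using filterlim_at_top_dense filterlim_real_sequentially by blast
    thus "\<forall>\<^sub>F n in sequentially. norm ((F (H b) - F (H a)) - (F (- of_nat n + \<i>) - F (- of_nat n - \<i>)))
            \<le> M * exp (- Y / 4)"
    proof eventually_elim
      case (elim n)
      have n: "real n > Y" "1 < c * real n" using elim c by (auto simp: pos_divide_less_eq mult.commute)
      have *: "norm (F z - F z') \<le> K * (2 + 4 * c) * exp (- Y / 4)"
        if "z \<in> hankel_tail \<sigma> c Y" "z' \<in> hankel_tail \<sigma> c Y" "\<bar>\<sigma>\<bar> = 1" for z z' \<sigma>
        using that X Y K F hankel_tail_not_nonpos_Reals
        by (intro hankel_tail_primitive_bound[where X = X and \<sigma> = \<sigma> and f = f]) auto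
      have eq: "F (H b) - F (H a) - (F (- of_nat n + \<i>) - F (- of_nat n - \<i>)) =
          (F (H b) - F (- of_nat n + \<i>)) - (F (H a) - F (- of_nat n - \<i>))"
        by simp
      have "norm (F (H b) - F (- of_nat n + \<i>)) \<le> K * (2 + 4 * c) * exp (- Y / 4)"
        using ab n by (intro *[of _ 1]) (auto simp: ends_in_hankel_tails_def hankel_tail_def)
      moreover have "norm (F (H a) - F (- of_nat n - \<i>)) \<le> K * (2 + 4 * c) * exp (- Y / 4)"
        using ab n by (intro *[of _ "-1"]) (auto simp: ends_in_hankel_tails_def hankel_tail_def)
      moreover have "M * exp (- Y / 4) = 2 * (K * (2 + 4 * c) * exp (- Y / 4))"
        by (simp add: M_def)
      ultimately show ?case
        unfolding eq using norm_triangle_ineq4[of "F (H b) - F (- of_nat n + \<i>)" "F (H a) - F (- of_nat n - \<i>)"]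
        by linarith
    qed
  qed simp
  have "((\<lambda>(a, b). F (H b) - F (H a)) \<longlongrightarrow> I) (at_bot \<times>\<^sub>F at_top)"
  proof (rule tendsto_exp_bound)
    fix Y assume "X \<le> Y"
    with ends[of Y] bound show "\<forall>\<^sub>F p in at_bot \<times>\<^sub>F at_top.
        norm ((case p of (a, b) \<Rightarrow> F (H b) - F (H a)) - I) \<le> M * exp (- Y / 4)"
      by (auto elim!: eventually_mono)
  qed
  moreover have "contour_integral (H \<circ> linepath a b) f = F (H b) - F (H a)" for a b
    using contour by (rule contour_integral_unique)
  moreover have "f contour_integrable_on (H \<circ> linepath a b)" for a b
    using contour unfolding contour_integrable_on_def by blast
  ultimately show ?thesis
    unfolding has_hankel_integral_def by presburger
qed

text \<open>The argument of \<open>z\<close> has modulus at most \<open>pi\<close>, so the imaginary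
  part of \<open>s\<close> contributes at most a constant factor.\<close>

lemma norm_powr_complex_le:
  fixes z s :: complex
  assumes "1 \<le> norm z"
  shows "norm (z powr s) \<le> exp (pi * \<bar>Im s\<bar>) * norm z powr Re s"
proof -
  have nz: "z \<noteq> 0" using assms by auto
  have "- (Im s * Im (Ln z)) \<le> \<bar>Im s\<bar> * \<bar>Im (Ln z)\<bar>"
    by (metis abs_ge_minus_self abs_mult)
  also have "\<dots> \<le> \<bar>Im s\<bar> * pi"
    using mpi_less_Im_Ln[OF nz] Im_Ln_le_pi[OF nz] by (intro mult_left_mono) auto
  finally have "- (Im s * Im (Ln z)) \<le> pi * \<bar>Im s\<bar>" by (simp add: mult.commute)
  thus ?thesis using nz by (simp add: powr_def norm_exp_eq_Re flip: exp_add)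
qed

text \<open>This is \<open>y \<le> exp y\<close> at \<open>y = x / (2 * p)\<close>, raised to the
  power \<open>p\<close>.\<close>

lemma powr_le_exp_half:
  fixes p x :: real
  assumes "p > 0" "x > 0"
  shows "x powr p \<le> (2 * p) powr p * exp (x / 2)"
proof -
  have "x / (2 * p) \<le> exp (x / (2 * p))"
    using exp_ge_add_one_self[of "x / (2 * p)"] by linarith
  hence "x \<le> 2 * p * exp (x / (2 * p))" using assms by (simp add: field_simps)
  hence "x powr p \<le> (2 * p * exp (x / (2 * p))) powr p"
    using assms by (intro powr_mono2) auto
  also have "\<dots> = (2 * p) powr p * exp (x / 2)"
    using assms by (simp add: powr_mult powr_def[of "exp _"] field_simps)
  finally show ?thesis .
qed

text \<open>In a tail \<open>norm z\<close> is at most a multiple of \<open>- Re z\<close>, so half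
  of the exponential decay pays for the power.\<close>

lemma exp_mult_powr_hankel_tail_bound:
  fixes s :: complex
  assumes "c > 0"
  obtains K where "K \<ge> 0" and "\<And>\<sigma> z. \<bar>\<sigma>\<bar> = 1 \<Longrightarrow> z \<in> hankel_tail \<sigma> c 1 \<Longrightarrow>
      norm (exp z * z powr s) \<le> K * exp (Re z / 2)"
proof
  \<comment> \<open>This exponent is positive and at least \<open>Re s\<close>, so one monotone
    bound covers both signs of \<open>Re s\<close>.\<close>
  define p where "p = \<bar>Re s\<bar> + 1"
  define K where "K = exp (pi * \<bar>Im s\<bar>) * ((1 + c) powr p * (2 * p) powr p)"
  have p: "p > 0" by (simp add: p_def)
  show "K \<ge> 0" by (simp add: K_def)
  fix \<sigma> :: real and z :: complex assume \<sigma>: "\<bar>\<sigma>\<bar> = 1" and z: "z \<in> hankel_tail \<sigma> c 1"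
  define x where "x = - Re z"
  have x: "x > 1" using z by (simp add: hankel_tail_def x_def)
  have Im: "\<bar>Im z\<bar> < c * x"
  proof -
    have "\<bar>Im z\<bar> = \<bar>\<sigma> * Im z\<bar>" using \<sigma> by (simp add: abs_mult)
    thus ?thesis using z by (simp add: hankel_tail_def x_def)
  qed
  have norm_ge: "1 \<le> norm z" using abs_Re_le_cmod[of z] x by (simp add: x_def)
  have norm_le: "norm z \<le> (1 + c) * x"
    using cmod_le[of z] Im x by (simp add: x_def algebra_simps)
  have "norm (z powr s) \<le> exp (pi * \<bar>Im s\<bar>) * norm z powr Re s"
    by (rule norm_powr_complex_le[OF norm_ge])
  also have "norm z powr Re s \<le> norm z powr p"
    using norm_ge by (intro powr_mono) (auto simp: p_def)
  also have "\<dots> \<le> ((1 + c) * x) powr p"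
    using norm_le p by (intro powr_mono2) auto
  also have "\<dots> = (1 + c) powr p * x powr p"
    using assms x by (simp add: powr_mult)
  also have "x powr p \<le> (2 * p) powr p * exp (x / 2)"
    using p x by (intro powr_le_exp_half) auto
  finally have "norm (z powr s) \<le> K * exp (x / 2)"
    by (simp add: K_def mult_left_mono mult.assoc)
  hence "exp (- x) * norm (z powr s) \<le> exp (- x) * (K * exp (x / 2))"
    by (intro mult_left_mono) auto
  also have "\<dots> = K * exp (- x / 2)" by (simp add: mult.left_commute flip: exp_add)
  finally show "norm (exp z * z powr s) \<le> K * exp (Re z / 2)"
    by (simp add: norm_mult norm_exp_eq_Re x_def)
qed

section \<open>Hankel's formula\<close>

lemma slit_plane_eq: "- \<real>\<^sub>\<le>\<^sub>0 = - (complex_of_real ` {..0})"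
  by (auto simp: nonpos_Reals_def)

lemma starlike_slit_plane: "starlike (- \<real>\<^sub>\<le>\<^sub>0 :: complex set)"
  unfolding slit_plane_eq by (rule starlike_slotted_complex_plane_left)

lemma open_slit_plane: "open (- \<real>\<^sub>\<le>\<^sub>0 :: complex set)"
  by (simp add: open_Compl)

lemma slit_plane_primitive:
  assumes "f holomorphic_on (- \<real>\<^sub>\<le>\<^sub>0)"
  obtains F where "\<And>z. z \<notin> \<real>\<^sub>\<le>\<^sub>0 \<Longrightarrow> (F has_field_derivative f z) (at z)"
proof -
  have "\<exists>F. \<forall>z\<in>- \<real>\<^sub>\<le>\<^sub>0. (F has_field_derivative f z) (at z)"
    using assms open_slit_plane
    by (intro holomorphic_starlike_primitive[where k = "{}"] starlike_slit_plane
          holomorphic_on_imp_continuous_on)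
       (auto intro: holomorphic_on_imp_differentiable_at)
  thus ?thesis using that by auto
qed

text \<open>Absolute integrability lets Euler's integral be approached by truncations, which arise
  below as increments of a primitive along the negative axis.\<close>

lemma tendsto_integral_Gamma:
  fixes z :: complex
  assumes "Re z > 0"
  shows "(\<lambda>n. integral {0..real n} (\<lambda>t. of_real t powr (z - 1) / of_real (exp t))) \<longlonglongrightarrow> Gamma z"
proof -
  let ?g = "\<lambda>t. complex_of_real t powr (z - 1) / of_real (exp t)"
  have "?g absolutely_integrable_on {0<..}"
    using absolutely_integrable_Gamma_integral[OF assms, of 1] by simp
  hence *: "set_integrable lebesgue {0..} ?g"
    by (rule absolutely_integrable_spike_set; intro negligible_subset[OF negligible_sing[of 0]]) auto
  have sub: "set_integrable lebesgue {0..b} ?g" for b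
    using * by (rule set_integrable_subset) auto
  have "((\<lambda>b. LINT t:{0..b}|lebesgue. ?g t) \<longlongrightarrow> (LINT t:{0..}|lebesgue. ?g t)) at_top"
    by (intro tendsto_set_lebesgue_integral_at_top *) auto
  hence "((\<lambda>b. integral {0..b} ?g) \<longlongrightarrow> integral {0..} ?g) at_top"
    by (simp add: set_lebesgue_integral_eq_integral(2) * sub)
  also have "integral {0..} ?g = Gamma z"
    using Gamma_integral_complex[OF assms] by (rule integral_unique)
  finally show ?thesis
    by (rule filterlim_compose) (rule filterlim_real_sequentially)
qed

text \<open>Rewriting \<open>\<tau>\<^sup>-\<^sup>s\<close> in terms of \<open>(- \<i> \<tau>)\<^sup>-\<^sup>s\<close> makes it continuous on the closed upper half-plane.\<close>

lemma powr_rotate_upper_half_plane: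
  fixes z s :: complex
  assumes "Im z \<ge> 0" "z \<noteq> 0"
  shows "(- \<i> * z) powr (- s) * exp (- \<i> * of_real pi * s / 2) = z powr (- s)"
proof -
  have "Ln (\<i> * (- \<i> * z)) = Ln (- \<i> * z) + \<i> * of_real pi / 2"
    using assms by (subst Ln_times_ii) auto
  hence eq: "Ln z = Ln (- \<i> * z) + \<i> * of_real pi / 2"
    by (simp flip: mult.assoc)
  have "(- \<i> * z) powr (- s) * exp (- \<i> * of_real pi * s / 2) =
          exp (- s * Ln (- \<i> * z) + - \<i> * of_real pi * s / 2)"
    using assms by (simp add: powr_def flip: exp_add)
  also have "\<dots> = exp (- s * Ln z)"
    by (rule arg_cong[of _ _ exp]) (subst eq, simp add: algebra_simps)
  finally show ?thesis using assms by (simp add: powr_def)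
qed

text \<open>The increment of \<open>F\<close> is taken along the upper side of the slit, through
  \<open>1\<close>, \<open>0\<close>, \<open>- n\<close> and \<open>- n + \<i>\<close>. The first
  leg gives the integral over \<open>{0..1}\<close>, the second a truncated Euler integral with a
  phase, and the third vanishes in the limit. \<open>Re s < 0\<close> makes the integrand continuous
  at \<open>0\<close>.\<close>

lemma exp_powr_upper_limit:
  fixes s :: complex
  assumes s: "Re s < 0"
    and F: "\<And>z. z \<notin> \<real>\<^sub>\<le>\<^sub>0 \<Longrightarrow> (F has_field_derivative (exp z * z powr (- s))) (at z)"
  shows "(\<lambda>n. F (- of_nat n + \<i>) - F 1) \<longlonglongrightarrow>
           - (exp (- \<i> * of_real pi * s) * Gamma (1 - s)
              + integral {0..1} (\<lambda>x::real. exp (of_real x) * of_real x powr (- s)))"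
proof -
  define U where "U = {z. Im z \<ge> 0}"
  \<comment> \<open>\<open>h\<close> agrees with the integrand on \<open>U\<close> away from
    \<open>0\<close> and is continuous on all of \<open>U\<close>. Its primitive \<open>P\<close>
    therefore reaches the negative axis, where nothing is known about \<open>F\<close>.\<close>
  define h where "h = (\<lambda>z. exp z * ((- \<i> * z) powr (- s) * exp (- \<i> * of_real pi * s / 2)))"
  have h_eq: "h z = exp z * z powr (- s)" if "z \<in> U" "z \<noteq> 0" for z
    using powr_rotate_upper_half_plane[of z s] that by (simp add: h_def U_def)
  have U: "convex U" "interior U = {z. Im z > 0}"
    using convex_halfspace_Im_ge[of 0] interior_halfspace_ge[of \<i> 0]
    by (auto simp: U_def inner_complex_def)
  obtain P where P: "\<And>z. z \<in> U \<Longrightarrow> (P has_field_derivative h z) (at z within U)"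
  proof (rule holomorphic_convex_primitive[OF U(1), of "{}" h])
    show "continuous_on U h"
      unfolding h_def using s by (intro continuous_intros) (auto simp: U_def)
    show "h field_differentiable at z" if "z \<in> interior U - {}" for z
      using that unfolding h_def
      by (intro holomorphic_on_imp_differentiable_at[of _ "{z. Im z > 0}"] holomorphic_intros)
         (auto simp: U open_halfspace_Im_gt complex_nonpos_Reals_iff)
  qed (auto intro: that)
  \<comment> \<open>This convex set avoids the slit but contains \<open>1\<close> and all points
    \<open>- n + \<i>\<close>; on it \<open>F\<close> and \<open>P\<close> are primitives of the
    same function.\<close>
  define V where "V = insert 1 {z. Im z > 0}"
  have "convex V"
  proof (rule convexI)
    fix x y u v assume *: "x \<in> V" "y \<in> V" "0 \<le> u" "0 \<le> v" "u + v = (1::real)"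
    have Im: "Im x \<ge> 0" "Im y \<ge> 0" using * by (auto simp: V_def)
    consider "u = 0" | "v = 0" | "u > 0" "v > 0" "Im x > 0 \<or> Im y > 0" | "x = 1" "y = 1"
      using * by (fastforce simp: V_def)
    thus "u *\<^sub>R x + v *\<^sub>R y \<in> V"
    proof cases
      case 3
      have "u * Im x + v * Im y > 0"
        using 3 Im by (auto intro: add_pos_nonneg add_nonneg_pos)
      thus ?thesis by (simp add: V_def)
    next
      case 4
      have "u *\<^sub>R x + v *\<^sub>R y = (u + v) *\<^sub>R 1" using 4 by (simp only: scaleR_add_left)
      thus ?thesis using * by (simp add: V_def)
    qed (use * in auto)
  qed
  have V: "z \<in> U" "z \<notin> \<real>\<^sub>\<le>\<^sub>0" if "z \<in> V" for z
    using that by (auto simp: V_def U_def complex_nonpos_Reals_iff)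
  have "\<exists>k. \<forall>z\<in>V. F z - P z = k"
  proof (rule has_field_derivative_zero_constant[OF \<open>convex V\<close>])
    fix z assume z: "z \<in> V"
    have "z \<noteq> 0" using V(2)[OF z] by auto
    hence "(F has_field_derivative h z) (at z within V)"
      using has_field_derivative_at_within[OF F[OF V(2)[OF z]], of V] h_eq[of z] V[OF z] by auto
    moreover have "(P has_field_derivative h z) (at z within V)"
      using P V z by (meson has_field_derivative_subset subsetI)
    ultimately show "((\<lambda>z. F z - P z) has_field_derivative 0) (at z within V)"
      by (auto intro!: derivative_eq_intros)
  qed
  then obtain k where k: "\<And>z. z \<in> V \<Longrightarrow> F z = P z + k"
    by (metis diff_eq_eq add.commute)
  have real_FTC: "((\<lambda>x::real. h (of_real x)) has_integral (P (of_real b) - P (of_real a))) {a..b}"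
    if "a \<le> b" for a b
  proof (rule fundamental_theorem_of_calculus[OF that])
    fix x assume "x \<in> {a..b}"
    have "(of_real has_vector_derivative 1) (at x within {a..b})"
      by (auto intro!: derivative_eq_intros)
    moreover have "(P has_field_derivative h (of_real x)) (at (of_real x) within of_real ` {a..b})"
      by (rule has_field_derivative_subset[OF P]) (auto simp: U_def)
    ultimately show "((\<lambda>x. P (of_real x)) has_vector_derivative h (of_real x)) (at x within {a..b})"
      using field_vector_diff_chain_within[of of_real 1 x "{a..b}" P "h (of_real x)"]
      by (simp add: o_def)
  qed
  \<comment> \<open>After the reflection \<open>x = - t\<close>, the argument \<open>pi\<close> of
    \<open>- t\<close> contributes the phase, and the Euler integrand of
    \<open>Gamma (1 - s)\<close> remains.\<close>
  have left: "(\<lambda>n. P 0 - P (- of_nat n)) \<longlonglongrightarrow> exp (- \<i> * of_real pi * s) * Gamma (1 - s)"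
  proof -
    let ?g = "\<lambda>t. complex_of_real t powr (1 - s - 1) / of_real (exp t)"
    have "h (of_real (- t)) = exp (- \<i> * of_real pi * s) * ?g t" if "t \<ge> 0" for t :: real
    proof (cases "t = 0")
      case True
      thus ?thesis by (simp add: h_def)
    next
      case False
      hence "h (of_real (- t)) = exp (of_real (- t)) * of_real (- t) powr (- s)"
        by (intro h_eq) (auto simp: U_def)
      also have "of_real (- t) powr (- s) = exp (- \<i> * of_real pi * s) * of_real t powr (- s)"
        using False that by (simp add: powr_def Ln_minus Ln_of_real algebra_simps flip: exp_add)
      finally show ?thesis by (simp add: exp_minus field_simps exp_of_real)
    qed
    hence "integral {0..real n} (\<lambda>t. exp (- \<i> * of_real pi * s) * ?g t) = P 0 - P (- of_nat n)" for n
    proof -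
      have "((\<lambda>t. h (of_real (- t))) has_integral (P 0 - P (- of_nat n))) {0..real n}"
        using has_integral_reflect_lemma_real[OF real_FTC[of "- real n" 0]] by simp
      hence "((\<lambda>t. exp (- \<i> * of_real pi * s) * ?g t) has_integral (P 0 - P (- of_nat n))) {0..real n}"
        by (rule has_integral_eq[rotated])
           (use \<open>\<And>t. t \<ge> 0 \<Longrightarrow> h (of_real (- t)) = exp (- \<i> * of_real pi * s) * ?g t\<close> in auto)
      thus ?thesis by (rule integral_unique)
    qed
    moreover have "(\<lambda>n. exp (- \<i> * of_real pi * s) * integral {0..real n} ?g) \<longlonglongrightarrow>
        exp (- \<i> * of_real pi * s) * Gamma (1 - s)"
      using s by (intro tendsto_intros tendsto_integral_Gamma) auto
    ultimately show ?thesis by (simp only: integral_mult_right)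
  qed
  have right: "P 1 - P 0 = integral {0..1} (\<lambda>x::real. exp (of_real x) * of_real x powr (- s))"
  proof -
    have "h (of_real x) = exp (of_real x) * of_real x powr (- s)" if "x \<in> {0..1}" for x :: real
      using that h_eq[of "of_real x"] by (cases "x = 0") (auto simp: U_def h_def)
    hence "integral {0..1} (\<lambda>x::real. h (of_real x)) =
             integral {0..1} (\<lambda>x::real. exp (of_real x) * of_real x powr (- s))"
      by (intro integral_cong) auto
    thus ?thesis using integral_unique[OF real_FTC[of 0 1]] by simp
  qed
  \<comment> \<open>The segment has length \<open>1\<close>, and \<open>exp (- n)\<close> beats the
    power of \<open>n + 1\<close>.\<close>
  have vertical: "(\<lambda>n. P (- of_nat n + \<i>) - P (- of_nat n)) \<longlonglongrightarrow> 0"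
  proof (rule Lim_null_comparison)
    define B where "B = (\<lambda>n. exp (- real n) * (exp (pi * \<bar>Im s\<bar>) * (real n + 1) powr (- Re s)))"
    show "B \<longlonglongrightarrow> 0" unfolding B_def by real_asymp
    show "\<forall>\<^sub>F n in sequentially. norm (P (- of_nat n + \<i>) - P (- of_nat n)) \<le> B n"
    proof (rule eventually_sequentiallyI[of 1])
      fix n :: nat assume n: "n \<ge> 1"
      let ?S = "closed_segment (- of_nat n) (- of_nat n + \<i>)"
      have S: "Re z = - real n" "0 \<le> Im z" "Im z \<le> 1" if "z \<in> ?S" for z
      proof -
        from that obtain u where u: "0 \<le> u" "u \<le> 1"
          "z = (1 - u) *\<^sub>R (- of_nat n) + u *\<^sub>R (- of_nat n + \<i>)"
          by (auto simp: in_segment)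
        have z: "z = - of_nat n + u *\<^sub>R \<i>"
          unfolding u(3)
          by (simp add: scaleR_conv_of_real algebra_simps)
        show "Re z = - real n" "0 \<le> Im z" "Im z \<le> 1"
          using u(1,2) by (auto simp: z)
      qed
      have "norm (P (- of_nat n + \<i>) - P (- of_nat n)) \<le> B n * norm (- of_nat n + \<i> - (- of_nat n))"
      proof (rule field_differentiable_bound[where S = ?S and f' = h])
        fix z assume z: "z \<in> ?S"
        show "(P has_field_derivative h z) (at z within ?S)"
          by (rule has_field_derivative_subset[OF P]) (use S z in \<open>auto simp: U_def\<close>)
        have norm_ge: "1 \<le> norm z" using abs_Re_le_cmod[of z] S[OF z] n by simp
        have norm_le: "norm z \<le> real n + 1" using cmod_le[of z] S[OF z] by simp
        have "norm (z powr (- s)) \<le> exp (pi * \<bar>Im s\<bar>) * norm z powr (- Re s)"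
          using norm_powr_complex_le[OF norm_ge, of "- s"] by simp
        also have "\<dots> \<le> exp (pi * \<bar>Im s\<bar>) * (real n + 1) powr (- Re s)"
          using norm_le s by (intro mult_left_mono powr_mono2) auto
        finally have "exp (- real n) * norm (z powr (- s)) \<le> B n"
          unfolding B_def by (intro mult_left_mono) auto
        moreover have "h z = exp z * z powr (- s)"
          using S[OF z] norm_ge by (intro h_eq) (auto simp: U_def)
        ultimately show "norm (h z) \<le> B n"
          using S[OF z] by (simp add: norm_mult norm_exp_eq_Re)
      qed auto
      thus "norm (P (- of_nat n + \<i>) - P (- of_nat n)) \<le> B n" by simp
    qed
  qed
  have "F (- of_nat n + \<i>) - F 1 =
      (P (- of_nat n + \<i>) - P (- of_nat n)) - ((P 0 - P (- of_nat n)) + (P 1 - P 0))" for n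
    by (simp add: k V_def)
  moreover have "(\<lambda>n. (P (- of_nat n + \<i>) - P (- of_nat n)) - ((P 0 - P (- of_nat n)) + (P 1 - P 0)))
      \<longlonglongrightarrow> 0 - (exp (- \<i> * of_real pi * s) * Gamma (1 - s) + (P 1 - P 0))"
    by (intro tendsto_intros vertical left)
  ultimately show ?thesis by (simp add: right)
qed

text \<open>Conjugation carries the limit at the upper end to the lower end. The integrals over
  \<open>{0..1}\<close> cancel, the two phases combine to a sine, and the reflection formula turns
  this sine times \<open>Gamma (1 - s)\<close> into a reciprocal Gamma value.\<close>

lemma exp_powr_symmetric_limit_Re_neg:
  fixes s :: complex
  assumes s: "Re s < 0"
    and F: "\<And>z. z \<notin> \<real>\<^sub>\<le>\<^sub>0 \<Longrightarrow> (F has_field_derivative (exp z * z powr (- s))) (at z)"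
  shows "(\<lambda>n. F (- of_nat n + \<i>) - F (- of_nat n - \<i>)) \<longlonglongrightarrow> 2 * of_real pi * \<i> * rGamma s"
proof -
  define J where "J = (\<lambda>s. integral {0..1} (\<lambda>x::real. exp (of_real x) * complex_of_real x powr (- s)))"
  have upper: "(\<lambda>n. F (- of_nat n + \<i>) - F 1) \<longlonglongrightarrow> - (exp (- \<i> * of_real pi * s) * Gamma (1 - s) + J s)"
    unfolding J_def by (rule exp_powr_upper_limit[OF s F])
  \<comment> \<open>A primitive of the integrand for \<open>cnj s\<close>; its values at the upper
    test points are conjugates of values of \<open>F\<close> at the lower ones.\<close>
  define F' where "F' = cnj \<circ> F \<circ> cnj"
  have F': "(F' has_field_derivative (exp z * z powr (- cnj s))) (at z)" if z: "z \<notin> \<real>\<^sub>\<le>\<^sub>0" for z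
  proof -
    have "cnj z \<notin> \<real>\<^sub>\<le>\<^sub>0" using z by (simp add: complex_nonpos_Reals_iff)
    have "cnj (cnj z powr (- s)) = z powr (- cnj s)"
      using cnj_powr[of "cnj z" "- s"] z by (auto simp: complex_nonpos_Reals_iff)
    with has_field_derivative_cnj_cnj[OF F[OF \<open>cnj z \<notin> \<real>\<^sub>\<le>\<^sub>0\<close>]] show ?thesis
      by (simp add: F'_def exp_cnj)
  qed
  have "(\<lambda>n. F' (- of_nat n + \<i>) - F' 1) \<longlonglongrightarrow>
          - (exp (- \<i> * of_real pi * cnj s) * Gamma (1 - cnj s) + J (cnj s))"
    unfolding J_def using s by (intro exp_powr_upper_limit F') auto
  from tendsto_cnj[OF this]
  have "(\<lambda>n. F (- of_nat n - \<i>) - F 1) \<longlonglongrightarrow> - (exp (\<i> * of_real pi * s) * Gamma (1 - s) + cnj (J (cnj s)))"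
    by (simp add: F'_def exp_cnj cnj_Gamma minus_diff_commute)
  also have "cnj (J (cnj s)) = J s"
    unfolding J_def integral_cnj
    by (intro integral_cong) (simp add: exp_cnj cnj_powr)
  finally have "(\<lambda>n. F (- of_nat n + \<i>) - F 1 - (F (- of_nat n - \<i>) - F 1)) \<longlonglongrightarrow>
      - (exp (- \<i> * of_real pi * s) * Gamma (1 - s) + J s)
      - - (exp (\<i> * of_real pi * s) * Gamma (1 - s) + J s)"
    by (intro tendsto_diff upper)
  also have "- (exp (- \<i> * of_real pi * s) * Gamma (1 - s) + J s)
      - - (exp (\<i> * of_real pi * s) * Gamma (1 - s) + J s) =
      2 * \<i> * sin (of_real pi * s) * Gamma (1 - s)"
    by (simp add: sin_exp_eq field_simps)
  also have "\<dots> = 2 * of_real pi * \<i> * rGamma s"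
  proof -
    have "1 - s \<notin> \<int>\<^sub>\<le>\<^sub>0" using s by (auto elim!: nonpos_Ints_cases simp: complex_eq_iff)
    hence "rGamma (1 - s) * Gamma (1 - s) = 1" by (simp add: rGamma_inverse_Gamma Gamma_eq_zero_iff)
    moreover have "sin (of_real pi * s) = of_real pi * (rGamma s * rGamma (1 - s))"
      by (simp add: rGamma_reflection_complex)
    ultimately show ?thesis by simp
  qed
  finally show ?thesis by simp
qed

text \<open>These are the boundary terms of the integration by parts in the induction on
  \<open>s\<close>; the decay in tails of slope \<open>1\<close> removes them.\<close>

lemma exp_powr_tendsto_0:
  fixes s :: complex
  assumes "\<bar>\<sigma>\<bar> = 1"
  shows "(\<lambda>n. exp (- of_nat n + of_real \<sigma> * \<i>) * (- of_nat n + of_real \<sigma> * \<i>) powr s) \<longlonglongrightarrow> 0"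
proof -
  obtain K where "K \<ge> 0" and K: "\<And>\<sigma> z. \<bar>\<sigma>\<bar> = 1 \<Longrightarrow> z \<in> hankel_tail \<sigma> 1 1 \<Longrightarrow>
      norm (exp z * z powr s) \<le> K * exp (Re z / 2)"
    by (rule exp_mult_powr_hankel_tail_bound[of 1 s]) simp_all
  show ?thesis
  proof (rule Lim_null_comparison)
    show "\<forall>\<^sub>F n in sequentially. norm (exp (- of_nat n + of_real \<sigma> * \<i>) * (- of_nat n + of_real \<sigma> * \<i>) powr s)
            \<le> K * exp (- real n / 2)"
    \<comment> \<open>The point for \<open>n = 1\<close> is on the boundary of the tail, so the
      estimate starts at \<open>2\<close>.\<close>
    proof (rule eventually_sequentiallyI[of 2])
      fix n :: nat assume n: "n \<ge> 2"
      have "\<sigma> * \<sigma> = 1" using assms by (metis abs_mult_self_eq mult_1)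
      hence "- of_nat n + of_real \<sigma> * \<i> \<in> hankel_tail \<sigma> 1 1"
        using n by (simp add: hankel_tail_def)
      from K[OF assms this] show "norm (exp (- of_nat n + of_real \<sigma> * \<i>) * (- of_nat n + of_real \<sigma> * \<i>) powr s)
            \<le> K * exp (- real n / 2)" by simp
    qed
    show "(\<lambda>n. K * exp (- real n / 2)) \<longlonglongrightarrow> 0" by real_asymp
  qed
qed

section \<open>Hankel's formula for arbitrary exponents\<close>

lemma slit_plane_constant:
  assumes "\<And>z. z \<notin> \<real>\<^sub>\<le>\<^sub>0 \<Longrightarrow> (f has_field_derivative 0) (at z)"
  obtains c where "\<And>z. z \<notin> \<real>\<^sub>\<le>\<^sub>0 \<Longrightarrow> f z = (c :: complex)"
proof -
  have "continuous_on (- \<real>\<^sub>\<le>\<^sub>0) f"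
    using assms DERIV_isCont by (intro continuous_at_imp_continuous_on) blast
  from DERIV_zero_connected_constant[OF starlike_imp_connected[OF starlike_slit_plane]
      open_slit_plane finite.emptyI this]
  obtain c where "\<And>z. z \<in> - \<real>\<^sub>\<le>\<^sub>0 \<Longrightarrow> f z = c" using assms by auto
  thus ?thesis using that by auto
qed

text \<open>The step from \<open>s - 1\<close> to \<open>s\<close> divides by \<open>s - 1\<close>,
  so \<open>s = 1\<close> needs its own argument: \<open>exp z / z\<close> is \<open>1 / z\<close>
  plus an entire function, and the jump of the logarithm across the slit supplies
  \<open>2 * pi * \<i>\<close>.\<close>

lemma exp_over_id_symmetric_limit:
  assumes F: "\<And>z. z \<notin> \<real>\<^sub>\<le>\<^sub>0 \<Longrightarrow> (F has_field_derivative (exp z / z)) (at z)"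
  shows "(\<lambda>n. F (- of_nat n + \<i>) - F (- of_nat n - \<i>)) \<longlonglongrightarrow> 2 * of_real pi * \<i>"
proof -
  \<comment> \<open>The difference quotient of \<open>exp\<close> at \<open>0\<close> with its
    removable singularity filled in; being entire, it has an entire primitive.\<close>
  define q where "q = (\<lambda>z::complex. if z = 0 then deriv exp 0 else (exp z - exp 0) / (z - 0))"
  have "q holomorphic_on UNIV"
    unfolding q_def by (rule pole_lemma) (auto intro: holomorphic_intros)
  then obtain E where E: "\<And>z. (E has_field_derivative q z) (at z)"
    using holomorphic_convex_primitive'[of UNIV q] by auto
  obtain k where k: "\<And>z. z \<notin> \<real>\<^sub>\<le>\<^sub>0 \<Longrightarrow> F z - (Ln z + E z) = k"
  proof (rule slit_plane_constant)
    fix z :: complex assume z: "z \<notin> \<real>\<^sub>\<le>\<^sub>0"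
    hence nz: "z \<noteq> 0" by auto
    have "exp z / z - (inverse z + q z) = 0" using nz by (simp add: q_def field_simps)
    thus "((\<lambda>z. F z - (Ln z + E z)) has_field_derivative 0) (at z)"
      using DERIV_diff[OF F[OF z] DERIV_add[OF has_field_derivative_Ln[OF z] E[of z]]] by simp
  qed auto
  \<comment> \<open>Negating both points changes their logarithms by \<open>pi * \<i>\<close> with
    opposite signs; the remaining difference involves no jump and tends to \<open>0\<close>.\<close>
  have Ln_diff: "Ln (- of_nat n + \<i>) - Ln (- of_nat n - \<i>) =
      2 * of_real pi * \<i> - (Ln (of_nat n + \<i>) - Ln (of_nat n - \<i>))" for n
  proof -
    have nz: "of_nat n - \<i> \<noteq> 0" "of_nat n + \<i> \<noteq> 0" by (auto simp: complex_eq_iff)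
    show ?thesis
      using Ln_minus[OF nz(1)] Ln_minus[OF nz(2)] by (simp add: minus_add_distrib)
  qed
  have seg: "Re z = c" if "z \<in> closed_segment (of_real c - \<i>) (of_real c + \<i>)" for z c
  proof -
    from that obtain u where "z = (1 - u) *\<^sub>R (of_real c - \<i>) + u *\<^sub>R (of_real c + \<i>)"
      by (auto simp: in_segment)
    hence "Re z = (1 - u) * c + u * c" by simp
    thus ?thesis by (simp add: algebra_simps)
  qed
  have Ln_lim: "(\<lambda>n. Ln (of_nat n + \<i>) - Ln (of_nat n - \<i>)) \<longlonglongrightarrow> 0"
  proof (rule Lim_null_comparison)
    show "\<forall>\<^sub>F n in sequentially. norm (Ln (of_nat n + \<i>) - Ln (of_nat n - \<i>)) \<le> 1 / real n * 2"
    proof (rule eventually_sequentiallyI[of 1])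
      fix n :: nat assume n: "n \<ge> 1"
      have "norm (Ln (of_nat n + \<i>) - Ln (of_nat n - \<i>)) \<le> 1 / real n * norm (of_nat n + \<i> - (of_nat n - \<i>))"
      proof (rule field_differentiable_bound[where S = "closed_segment (of_nat n - \<i>) (of_nat n + \<i>)"
              and f' = inverse])
        fix z assume "z \<in> closed_segment (of_nat n - \<i>) (of_nat n + \<i>)"
        hence Re: "Re z = real n" using seg[of z "real n"] by simp
        hence "z \<notin> \<real>\<^sub>\<le>\<^sub>0" using n by (simp add: complex_nonpos_Reals_iff)
        thus "(Ln has_field_derivative inverse z) (at z within closed_segment (of_nat n - \<i>) (of_nat n + \<i>))"
          by (intro has_field_derivative_at_within[OF has_field_derivative_Ln])
        have "real n \<le> norm z" using abs_Re_le_cmod[of z] Re by simp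
        thus "norm (inverse z) \<le> 1 / real n"
          using n le_imp_inverse_le[of "real n" "norm z"] by (simp add: norm_inverse inverse_eq_divide[of "real n"])
      qed auto
      thus "norm (Ln (of_nat n + \<i>) - Ln (of_nat n - \<i>)) \<le> 1 / real n * 2"
        by (simp add: norm_mult)
    qed
    show "(\<lambda>n. 1 / real n * 2) \<longlonglongrightarrow> 0" by real_asymp
  qed
  \<comment> \<open>On the vertical segment \<open>exp\<close> has modulus at most \<open>1\<close>,
    which bounds \<open>q\<close> by \<open>2 / n\<close>. The segment may cross the slit because
    \<open>E\<close> is entire.\<close>
  have E_lim: "(\<lambda>n. E (- of_nat n + \<i>) - E (- of_nat n - \<i>)) \<longlonglongrightarrow> 0"
  proof (rule Lim_null_comparison)
    show "\<forall>\<^sub>F n in sequentially. norm (E (- of_nat n + \<i>) - E (- of_nat n - \<i>)) \<le> 2 / real n * 2"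
    proof (rule eventually_sequentiallyI[of 1])
      fix n :: nat assume n: "n \<ge> 1"
      have "norm (E (- of_nat n + \<i>) - E (- of_nat n - \<i>)) \<le>
              2 / real n * norm (- of_nat n + \<i> - (- of_nat n - \<i>))"
      proof (rule field_differentiable_bound[where S = "closed_segment (- of_nat n - \<i>) (- of_nat n + \<i>)"
              and f' = q])
        fix z assume "z \<in> closed_segment (- of_nat n - \<i>) (- of_nat n + \<i>)"
        hence Re: "Re z = - real n" using seg[of z "- real n"] by simp
        show "(E has_field_derivative q z) (at z within closed_segment (- of_nat n - \<i>) (- of_nat n + \<i>))"
          by (rule has_field_derivative_at_within[OF E])
        have le: "real n \<le> norm z" using abs_Re_le_cmod[of z] Re by simp
        have nz: "z \<noteq> 0" using Re n by auto
        have "norm (exp z - 1) \<le> norm (exp z) + norm (1::complex)" by (rule norm_triangle_ineq4)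
        also have "\<dots> \<le> 2" by (simp add: norm_exp_eq_Re Re)
        finally have "norm (exp z - 1) / norm z \<le> 2 / real n"
          using le n by (intro frac_le) auto
        thus "norm (q z) \<le> 2 / real n" using nz by (simp add: q_def norm_divide)
      qed auto
      thus "norm (E (- of_nat n + \<i>) - E (- of_nat n - \<i>)) \<le> 2 / real n * 2"
        by (simp add: norm_mult)
    qed
    show "(\<lambda>n. 2 / real n * 2) \<longlonglongrightarrow> 0" by real_asymp
  qed
  have "F (- of_nat n + \<i>) - F (- of_nat n - \<i>) =
      2 * of_real pi * \<i> - (Ln (of_nat n + \<i>) - Ln (of_nat n - \<i>))
        + (E (- of_nat n + \<i>) - E (- of_nat n - \<i>))" for n
  proof -
    have "- of_nat n + \<i> \<notin> \<real>\<^sub>\<le>\<^sub>0" "- of_nat n - \<i> \<notin> \<real>\<^sub>\<le>\<^sub>0"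
      by (auto simp: complex_nonpos_Reals_iff)
    from k[OF this(1)] k[OF this(2)]
    have "F (- of_nat n + \<i>) - F (- of_nat n - \<i>) =
        (Ln (- of_nat n + \<i>) - Ln (- of_nat n - \<i>)) + (E (- of_nat n + \<i>) - E (- of_nat n - \<i>))"
      by (simp add: diff_eq_eq)
    thus ?thesis by (simp only: Ln_diff)
  qed
  moreover have "(\<lambda>n. 2 * of_real pi * \<i> - (Ln (of_nat n + \<i>) - Ln (of_nat n - \<i>))
        + (E (- of_nat n + \<i>) - E (- of_nat n - \<i>))) \<longlonglongrightarrow> 2 * of_real pi * \<i> - 0 + 0"
    by (intro tendsto_intros Ln_lim E_lim)
  ultimately show ?thesis by simp
qed

text \<open>Induction on a bound \<open>m\<close> for \<open>Re s\<close>, starting from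
  \<open>Re s < 0\<close>. With \<open>r = s - 1\<close>, integration by parts gives
  \<open>r * F = G - f\<close> up to a constant, where \<open>G\<close> is a primitive for the
  exponent \<open>r\<close>, and \<open>rGamma r = r * rGamma s\<close> matches the limits.\<close>

lemma exp_powr_symmetric_limit:
  fixes s :: complex
  assumes "\<And>z. z \<notin> \<real>\<^sub>\<le>\<^sub>0 \<Longrightarrow> (F has_field_derivative (exp z * z powr (- s))) (at z)"
  shows "(\<lambda>n. F (- of_nat n + \<i>) - F (- of_nat n - \<i>)) \<longlonglongrightarrow> 2 * of_real pi * \<i> * rGamma s"
proof -
  obtain m :: nat where "Re s < real m" using reals_Archimedean2 by blast
  thus ?thesis using assms
  proof (induction m arbitrary: s F)
    case 0
    thus ?case by (intro exp_powr_symmetric_limit_Re_neg) auto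
  next
    case (Suc m)
    note F = Suc.prems(2)
    show ?case
    proof (cases "s = 1")
      case True
      have "(F has_field_derivative (exp z / z)) (at z)" if "z \<notin> \<real>\<^sub>\<le>\<^sub>0" for z
      proof -
        have "z \<noteq> 0" using that by auto
        hence "exp z * z powr (- s) = exp z / z" by (simp add: True powr_minus field_simps)
        thus ?thesis using F[OF that] by simp
      qed
      from exp_over_id_symmetric_limit[OF this] show ?thesis by (simp add: True)
    next
      case False
      define r where "r = s - 1"
      have r: "r \<noteq> 0" using False by (simp add: r_def)
      define f where "f = (\<lambda>z. exp z * z powr (- r))"
      have "f holomorphic_on (- \<real>\<^sub>\<le>\<^sub>0)" unfolding f_def by (auto intro!: holomorphic_intros)
      then obtain G where G: "\<And>z. z \<notin> \<real>\<^sub>\<le>\<^sub>0 \<Longrightarrow> (G has_field_derivative f z) (at z)"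
        using slit_plane_primitive by blast
      have G_lim: "(\<lambda>n. G (- of_nat n + \<i>) - G (- of_nat n - \<i>)) \<longlonglongrightarrow> 2 * of_real pi * \<i> * rGamma r"
        using Suc.prems(1) G by (intro Suc.IH) (auto simp: r_def f_def)
      obtain k where k: "\<And>z. z \<notin> \<real>\<^sub>\<le>\<^sub>0 \<Longrightarrow> G z - r * F z - f z = k"
      proof (rule slit_plane_constant)
        fix z :: complex assume z: "z \<notin> \<real>\<^sub>\<le>\<^sub>0"
        have "(f has_field_derivative (exp z * z powr (- r) - r * (exp z * z powr (- s)))) (at z)"
          unfolding f_def using z
          by (auto intro!: derivative_eq_intros simp: r_def algebra_simps)
        from DERIV_diff[OF DERIV_diff[OF G[OF z] DERIV_cmult[OF F[OF z], of r]] this]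
        show "((\<lambda>z. G z - r * F z - f z) has_field_derivative 0) (at z)"
          by (simp add: f_def)
      qed auto
      have "F (- of_nat n + \<i>) - F (- of_nat n - \<i>) =
          ((G (- of_nat n + \<i>) - G (- of_nat n - \<i>)) - (f (- of_nat n + \<i>) - f (- of_nat n - \<i>))) / r" for n
      proof -
        have "- of_nat n + \<i> \<notin> \<real>\<^sub>\<le>\<^sub>0" "- of_nat n - \<i> \<notin> \<real>\<^sub>\<le>\<^sub>0"
          by (auto simp: complex_nonpos_Reals_iff)
        from k[OF this(1)] k[OF this(2)] show ?thesis
          using r by (simp add: field_simps)
      qed
      moreover have "(\<lambda>n. ((G (- of_nat n + \<i>) - G (- of_nat n - \<i>)) - (f (- of_nat n + \<i>) - f (- of_nat n - \<i>))) / r)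
          \<longlonglongrightarrow> (2 * of_real pi * \<i> * rGamma r - (0 - 0)) / r"
        unfolding f_def using r exp_powr_tendsto_0[of 1 "- r"] exp_powr_tendsto_0[of "-1" "- r"]
        by (intro tendsto_intros G_lim[unfolded f_def]) auto
      moreover have "rGamma r = r * rGamma s"
        using rGamma_plus1[of r] by (simp add: r_def)
      ultimately show ?thesis using r by (simp add: mult.assoc)
    qed
  qed
qed

lemma has_hankel_integral_rGamma:
  assumes "hankel_contour H"
  shows "has_hankel_integral (\<lambda>z. exp z * z powr (- s)) (2 * of_real pi * \<i> * rGamma s) H"
proof -
  have "(\<lambda>z. exp z * z powr (- s)) holomorphic_on (- \<real>\<^sub>\<le>\<^sub>0)"
    by (auto intro!: holomorphic_intros)
  then obtain F where F: "\<And>z. z \<notin> \<real>\<^sub>\<le>\<^sub>0 \<Longrightarrow> (F has_field_derivative (exp z * z powr (- s))) (at z)"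
    using slit_plane_primitive by blast
  show ?thesis
  proof (rule has_hankel_integral_primitive[OF assms F])
    fix c :: real assume "c > 0"
    then obtain K where "K \<ge> 0" and "\<And>\<sigma> z. \<bar>\<sigma>\<bar> = 1 \<Longrightarrow> z \<in> hankel_tail \<sigma> c 1 \<Longrightarrow>
      norm (exp z * z powr (- s)) \<le> K * exp (Re z / 2)"
      by (rule exp_mult_powr_hankel_tail_bound[of c "- s"]) simp_all
    thus "\<exists>X K. 0 \<le> X \<and> (\<forall>\<sigma> z. \<bar>\<sigma>\<bar> = 1 \<longrightarrow> z \<in> hankel_tail \<sigma> c X \<longrightarrow>
              norm (exp z * z powr (- s)) \<le> K * exp (Re z / 2))"
      by (intro exI[of _ 1] exI[of _ K]) auto
  qed (use exp_powr_symmetric_limit[OF F] in auto)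
qed

section \<open>Termwise integration\<close>

lemma has_hankel_integral_cmult:
  assumes "has_hankel_integral f I H"
  shows "has_hankel_integral (\<lambda>z. c * f z) (c * I) H"
  unfolding has_hankel_integral_def
proof
  have f: "f contour_integrable_on (H \<circ> linepath a b)" for a b
    using assms by (simp add: has_hankel_integral_def)
  thus "\<forall>a b. (\<lambda>z. c * f z) contour_integrable_on (H \<circ> linepath a b)"
    by (intro allI contour_integrable_lmul)
  have "((\<lambda>p. c * (\<lambda>(a, b). contour_integral (H \<circ> linepath a b) f) p) \<longlongrightarrow> c * I) (at_bot \<times>\<^sub>F at_top)"
    using assms by (intro tendsto_mult_left) (simp add: has_hankel_integral_def)
  thus "((\<lambda>(a, b). contour_integral (H \<circ> linepath a b) (\<lambda>z. c * f z)) \<longlongrightarrow> c * I) (at_bot \<times>\<^sub>F at_top)"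
    by (simp only: contour_integral_lmul[OF f] case_prod_unfold)
qed

lemma has_hankel_integral_sum:
  assumes "finite A" and "\<And>i. i \<in> A \<Longrightarrow> has_hankel_integral (f i) (I i) H"
  shows "has_hankel_integral (\<lambda>z. \<Sum>i\<in>A. f i z) (\<Sum>i\<in>A. I i) H"
  unfolding has_hankel_integral_def
proof
  have f: "f i contour_integrable_on (H \<circ> linepath a b)" if "i \<in> A" for i a b
    using assms(2)[OF that] by (simp add: has_hankel_integral_def)
  thus "\<forall>a b. (\<lambda>z. \<Sum>i\<in>A. f i z) contour_integrable_on (H \<circ> linepath a b)"
    by (intro allI contour_integrable_sum assms(1))
  have "((\<lambda>p. \<Sum>i\<in>A. (\<lambda>(a, b). contour_integral (H \<circ> linepath a b) (f i)) p) \<longlongrightarrow> (\<Sum>i\<in>A. I i))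
          (at_bot \<times>\<^sub>F at_top)"
    using assms by (intro tendsto_sum) (simp add: has_hankel_integral_def)
  moreover have "contour_integral (H \<circ> linepath a b) (\<lambda>z. \<Sum>i\<in>A. f i z) =
      (\<Sum>i\<in>A. contour_integral (H \<circ> linepath a b) (f i))" for a b
    using assms(1) f by (rule contour_integral_sum)
  ultimately show "((\<lambda>(a, b). contour_integral (H \<circ> linepath a b) (\<lambda>z. \<Sum>i\<in>A. f i z)) \<longlongrightarrow> (\<Sum>i\<in>A. I i))
          (at_bot \<times>\<^sub>F at_top)"
    by (simp only: case_prod_unfold)
qed

text \<open>Truncating the \<open>n\<close>-th term costs an error proportional to
  \<open>K n\<close>. Summability of \<open>K\<close> lets these errors be added, so termwise
  integration passes from finite pieces to the whole contour.\<close>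

lemma has_hankel_integral_series:
  assumes H: "hankel_contour H"
    and g: "\<And>n. has_hankel_integral (g n) (I n) H"
    and f: "\<And>a b. f contour_integrable_on (H \<circ> linepath a b)"
    and pieces: "\<And>a b. (\<lambda>n. contour_integral (H \<circ> linepath a b) (g n)) sums
                         contour_integral (H \<circ> linepath a b) f"
    and hol: "\<And>n. g n holomorphic_on (- \<real>\<^sub>\<le>\<^sub>0)"
    and tails: "\<And>c. c > 0 \<Longrightarrow> \<exists>X K. 0 \<le> X \<and> summable K \<and>
          (\<forall>n \<sigma> z. \<bar>\<sigma>\<bar> = 1 \<longrightarrow> z \<in> hankel_tail \<sigma> c X \<longrightarrow> norm (g n z) \<le> K n * exp (Re z / 2))"
    and J: "I sums J"
  shows "has_hankel_integral f J H"
proof -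
  obtain c where c: "c > 0"
    and ends: "\<And>Y. \<forall>\<^sub>F (a, b) in at_bot \<times>\<^sub>F at_top. ends_in_hankel_tails H c Y a b"
    using hankel_contour_ends_in_tails[OF H] by blast
  from tails[OF c] obtain X K where X: "0 \<le> X" and K: "summable K" and
    bound: "\<And>n \<sigma> z. \<bar>\<sigma>\<bar> = 1 \<Longrightarrow> z \<in> hankel_tail \<sigma> c X \<Longrightarrow> norm (g n z) \<le> K n * exp (Re z / 2)"
    by blast
  have hol_tail: "g n holomorphic_on hankel_tail \<sigma> c X" for n \<sigma>
    using hol by (rule holomorphic_on_subset) (auto dest: hankel_tail_not_nonpos_Reals)
  define M where "M = (\<Sum>n. K n) * (2 * (2 + 4 * c))"
  have "norm (contour_integral (H \<circ> linepath a b) f - J) \<le> M * exp (- Y / 4)"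
    if ab: "ends_in_hankel_tails H c Y a b" and Y: "X \<le> Y" for a b Y
  proof -
    let ?J = "\<lambda>f. contour_integral (H \<circ> linepath a b) f"
    have "(\<lambda>n. ?J (g n) - I n) sums (?J f - J)"
      by (intro sums_diff pieces J)
    hence "norm (?J f - J) = norm (\<Sum>n. ?J (g n) - I n)" by (simp add: sums_iff)
    also have "\<dots> \<le> (\<Sum>n. K n * (2 * (2 + 4 * c) * exp (- Y / 4)))"
    proof (rule norm_suminf_le)
      show "summable (\<lambda>n. K n * (2 * (2 + 4 * c) * exp (- Y / 4)))"
        using K by (rule summable_mult2)
      fix n
      have "norm (?J (g n) - I n) \<le> 2 * K n * (2 + 4 * c) * exp (- Y / 4)"
        by (rule hankel_integral_tail_bound[OF H g hol_tail bound ab X Y])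
      thus "norm (?J (g n) - I n) \<le> K n * (2 * (2 + 4 * c) * exp (- Y / 4))"
        by (simp add: mult_ac)
    qed
    also have "\<dots> = M * exp (- Y / 4)"
      using suminf_mult2[OF K, of "2 * (2 + 4 * c) * exp (- Y / 4)"] by (simp add: M_def mult.assoc)
    finally show ?thesis .
  qed
  note J_bound = this
  have "((\<lambda>(a, b). contour_integral (H \<circ> linepath a b) f) \<longlongrightarrow> J) (at_bot \<times>\<^sub>F at_top)"
  proof (rule tendsto_exp_bound)
    fix Y assume "X \<le> Y"
    with ends[of Y] J_bound show "\<forall>\<^sub>F p in at_bot \<times>\<^sub>F at_top.
        norm ((case p of (a, b) \<Rightarrow> contour_integral (H \<circ> linepath a b) f) - J) \<le> M * exp (- Y / 4)"
      by (auto elim!: eventually_mono)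
  qed
  thus ?thesis using f by (simp add: has_hankel_integral_def)
qed

section \<open>Bounds for Hankel integrals that are uniform in a holomorphic factor\<close>

lemma open_slit_plane_preimage:
  fixes f :: "complex \<Rightarrow> complex"
  assumes "continuous_on (- \<real>\<^sub>\<le>\<^sub>0) f"
  shows "open {z. z \<notin> \<real>\<^sub>\<le>\<^sub>0 \<and> norm (f z) < (r::real)}"
proof -
  have "open (- \<real>\<^sub>\<le>\<^sub>0 \<inter> (\<lambda>z. norm (f z)) -` {..<r})"
    using assms by (intro continuous_open_preimage continuous_intros open_slit_plane) auto
  also have "- \<real>\<^sub>\<le>\<^sub>0 \<inter> (\<lambda>z. norm (f z)) -` {..<r} = {z. z \<notin> \<real>\<^sub>\<le>\<^sub>0 \<and> norm (f z) < r}" by auto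
  finally show ?thesis .
qed

text \<open>The strict bound makes a sublevel set an open neighbourhood of the path, as estimates
  for holomorphic integrands require.\<close>

lemma contour_image_bounded:
  fixes f :: "complex \<Rightarrow> complex"
  assumes "valid_path g" and "path_image g \<subseteq> - \<real>\<^sub>\<le>\<^sub>0" and "continuous_on (- \<real>\<^sub>\<le>\<^sub>0) f"
  obtains M :: real where "M > 0" and "\<And>z. z \<in> path_image g \<Longrightarrow> norm (f z) < M"
proof -
  have "bounded (f ` path_image g)"
    using assms by (intro compact_imp_bounded compact_continuous_image compact_valid_path_image)
                   (auto intro: continuous_on_subset)
  then obtain M where "\<And>z. z \<in> path_image g \<Longrightarrow> norm (f z) \<le> M"
    unfolding bounded_iff by blast
  hence "\<And>z. z \<in> path_image g \<Longrightarrow> norm (f z) < \<bar>M\<bar> + 1" by fastforce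
  thus ?thesis using that[of "\<bar>M\<bar> + 1"] by simp
qed

text \<open>\<open>L\<close> depends on the contour and on \<open>s\<close> but not on
  \<open>q\<close>, so it serves a whole family of integrals. The contour is split into a compact
  piece and two ends in tails, where the factor \<open>exp z * z powr s\<close> decays.\<close>

lemma hankel_integral_bound:
  fixes s :: complex
  assumes H: "hankel_contour H" and R: "\<And>t. R < norm (H t)"
  obtains L where "L \<ge> 0" and "\<And>q B I. q holomorphic_on (- \<real>\<^sub>\<le>\<^sub>0) \<Longrightarrow>
      (\<And>z. z \<notin> \<real>\<^sub>\<le>\<^sub>0 \<Longrightarrow> R \<le> norm z \<Longrightarrow> norm (q z) \<le> B) \<Longrightarrow>
      has_hankel_integral (\<lambda>z. exp z * z powr s * q z) I H \<Longrightarrow> norm I \<le> L * B"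
proof -
  define e where "e = (\<lambda>z. exp z * z powr s)"
  have e_hol: "e holomorphic_on (- \<real>\<^sub>\<le>\<^sub>0)"
    unfolding e_def by (auto intro!: holomorphic_intros)
  note e_cont = holomorphic_on_imp_continuous_on[OF e_hol]
  obtain c where c: "c > 0"
    and ends: "\<And>Y. \<forall>\<^sub>F (a, b) in at_bot \<times>\<^sub>F at_top. ends_in_hankel_tails H c Y a b"
    using hankel_contour_ends_in_tails[OF H] by blast
  obtain K where K: "K \<ge> 0" "\<And>\<sigma> z. \<bar>\<sigma>\<bar> = 1 \<Longrightarrow> z \<in> hankel_tail \<sigma> c 1 \<Longrightarrow>
      norm (e z) \<le> K * exp (Re z / 2)"
    unfolding e_def by (rule exp_mult_powr_hankel_tail_bound[OF c, of s]) simp_all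
  \<comment> \<open>Depth \<open>1\<close> secures the decay estimate, and depth \<open>R\<close>
    forces \<open>R \<le> norm z\<close>, where \<open>B\<close> bounds \<open>q\<close>.\<close>
  define X where "X = max 1 R"
  have X: "0 \<le> X" "1 \<le> X" "R \<le> X" by (auto simp: X_def)
  have "(at_bot \<times>\<^sub>F at_top :: (real \<times> real) filter) \<noteq> bot"
    by (simp add: prod_filter_eq_bot)
  then obtain a b where ab: "ends_in_hankel_tails H c X a b"
    using eventually_happens[OF ends[of X]] by auto
  define g where "g = H \<circ> linepath a b"
  have g: "valid_path g" "path_image g \<subseteq> - \<real>\<^sub>\<le>\<^sub>0"
    using H unfolding hankel_contour_def g_def path_image_comp_linepath by auto
  obtain M where M: "M > 0" "\<And>z. z \<in> path_image g \<Longrightarrow> norm (e z) < M"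
    using contour_image_bounded[OF g e_cont] by blast
  \<comment> \<open>An open neighbourhood of the compact piece on which both factors of the
    integrand are bounded.\<close>
  define S where "S = {z. z \<notin> \<real>\<^sub>\<le>\<^sub>0 \<and> norm (e z) < M} \<inter> {z. R < norm z}"
  have "open S"
    unfolding S_def by (intro open_Int open_slit_plane_preimage e_cont open_Collect_less continuous_intros)
  moreover have "path_image g \<subseteq> S"
    using g M R unfolding S_def g_def path_image_comp_linepath by auto
  ultimately obtain L0 where L0: "L0 > 0" "\<And>f B. f holomorphic_on S \<Longrightarrow> (\<And>z. z \<in> S \<Longrightarrow> norm (f z) \<le> B) \<Longrightarrow>
      norm (contour_integral g f) \<le> L0 * B"
    using contour_integral_bound_exists[OF _ g(1)] by metis
  define L where "L = L0 * M + 2 * K * (2 + 4 * c) * exp (- X / 4)"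
  have "norm I \<le> L * B"
    if q: "q holomorphic_on (- \<real>\<^sub>\<le>\<^sub>0)" and B: "\<And>z. z \<notin> \<real>\<^sub>\<le>\<^sub>0 \<Longrightarrow> R \<le> norm z \<Longrightarrow> norm (q z) \<le> B"
      and I: "has_hankel_integral (\<lambda>z. e z * q z) I H" for q B I
  proof -
    have eq_hol: "(\<lambda>z. e z * q z) holomorphic_on (- \<real>\<^sub>\<le>\<^sub>0)"
      by (intro holomorphic_intros e_hol q)
    have "norm (contour_integral g (\<lambda>z. e z * q z)) \<le> L0 * (M * B)"
    proof (rule L0(2))
      show "(\<lambda>z. e z * q z) holomorphic_on S"
        using eq_hol by (rule holomorphic_on_subset) (auto simp: S_def)
      show "norm (e z * q z) \<le> M * B" if "z \<in> S" for z
        using that B[of z] M(1) by (auto simp: S_def norm_mult intro!: mult_mono)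
    qed
    moreover have "norm (contour_integral g (\<lambda>z. e z * q z) - I) \<le> 2 * (K * B) * (2 + 4 * c) * exp (- X / 4)"
      unfolding g_def
    proof (rule hankel_integral_tail_bound[OF H I _ _ ab X(1) order.refl])
      show "(\<lambda>z. e z * q z) holomorphic_on hankel_tail \<sigma> c X" for \<sigma>
        using eq_hol by (rule holomorphic_on_subset) (auto dest: hankel_tail_not_nonpos_Reals)
      show "norm (e z * q z) \<le> K * B * exp (Re z / 2)" if \<sigma>: "\<bar>\<sigma>\<bar> = 1" and z: "z \<in> hankel_tail \<sigma> c X" for \<sigma> z
      proof -
        have "norm (e z) \<le> K * exp (Re z / 2)"
          using hankel_tail_mono[OF X(2)] z by (intro K(2)[OF \<sigma>]) auto
        moreover have "R \<le> norm z"
          using z X abs_Re_le_cmod[of z] by (auto simp: hankel_tail_def)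
        hence "norm (q z) \<le> B" using hankel_tail_not_nonpos_Reals[OF z] by (intro B)
        ultimately have "norm (e z) * norm (q z) \<le> K * exp (Re z / 2) * B"
          using K(1) by (intro mult_mono) auto
        thus ?thesis by (simp add: norm_mult mult_ac)
      qed
    qed
    ultimately have "norm I \<le> L0 * (M * B) + 2 * (K * B) * (2 + 4 * c) * exp (- X / 4)"
      using norm_triangle_sub[of I "contour_integral g (\<lambda>z. e z * q z)"]
      by (simp add: norm_minus_commute)
    also have "\<dots> = L * B" by (simp add: L_def algebra_simps)
    finally show ?thesis .
  qed
  moreover have "L \<ge> 0" using L0(1) M(1) K(1) c by (simp add: L_def)
  ultimately show ?thesis using that unfolding e_def by blast
qed

section \<open>The trivariate series\<close>

definition triples_of_sum :: "nat \<Rightarrow> (nat \<times> nat \<times> nat) set" where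
  "triples_of_sum n = {(l, p, k). l + p + k = n}"

lemma sum_triples_of_sum:
  "(\<Sum>x\<in>triples_of_sum n. f x) = (\<Sum>l\<le>n. \<Sum>p\<le>n - l. f (l, p, n - l - p))"
  unfolding sum.Sigma[OF finite_atMost ballI[OF finite_atMost]]
  by (rule sum.reindex_bij_witness[where i = "\<lambda>(l, p). (l, p, n - l - p)" and j = "\<lambda>(l, p, k). (l, p)"])
     (auto simp: triples_of_sum_def)

lemma finite_triples_of_sum [simp]: "finite (triples_of_sum n)"
  by (rule finite_subset[of _ "{..n} \<times> {..n} \<times> {..n}"]) (auto simp: triples_of_sum_def)

text \<open>With the factorials divided out, the binomial theorem is a plain convolution; applying
  it twice gives the trinomial form without multinomial coefficients.\<close>

lemma binomial_exponential_form:
  fixes x y :: "'a :: {real_normed_field, banach}"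
  shows "(x + y) ^ n / fact n = (\<Sum>i\<le>n. (x ^ i / fact i) * (y ^ (n - i) / fact (n - i)))"
proof -
  have *: "z ^ m /\<^sub>R fact m = z ^ m / fact m" for z :: 'a and m
    by (simp add: scaleR_conv_of_real field_simps)
  show ?thesis
    using exp_series_add_commuting[of x y n] by (simp only: mult.commute[of x y] *)
qed

lemma trinomial_exponential_form:
  fixes x y z :: "'a :: {real_normed_field, banach}"
  shows "(x + y + z) ^ n / fact n =
           (\<Sum>(l, p, k)\<in>triples_of_sum n. x ^ l * y ^ p * z ^ k / (fact l * fact p * fact k))"
proof -
  have "(x + y + z) ^ n / fact n =
      (\<Sum>l\<le>n. (x ^ l / fact l) * (\<Sum>p\<le>n - l. (y ^ p / fact p) * (z ^ (n - l - p) / fact (n - l - p))))"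
    by (simp only: add.assoc binomial_exponential_form)
  thus ?thesis
    by (simp add: sum_triples_of_sum sum_distrib_left mult.assoc)
qed

text \<open>Each triple lies on exactly one diagonal, so absolute summability along diagonals is
  absolute summability over all triples. The iterated series is then reached by splitting off one
  coordinate at a time.\<close>

lemma sums_suminf_iterated:
  fixes t :: "nat \<times> nat \<times> nat \<Rightarrow> complex"
  assumes "summable (\<lambda>n. \<Sum>x\<in>triples_of_sum n. norm (t x))"
  shows "(\<lambda>n. \<Sum>x\<in>triples_of_sum n. t x) sums (\<Sum>l. \<Sum>p. \<Sum>k. t (l, p, k))"
proof -
  have suminf_eq: "suminf f = infsum f UNIV" if "f summable_on UNIV" for f :: "nat \<Rightarrow> complex"
    using has_sum_imp_sums[OF has_sum_infsum[OF that]] by (simp add: sums_iff)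
  have bij: "bij_betw snd (Sigma UNIV triples_of_sum) UNIV"
    by (rule bij_betwI[where g = "\<lambda>x. (case x of (l, p, k) \<Rightarrow> l + p + k, x)"])
       (auto simp: triples_of_sum_def)
  have "(\<lambda>n. \<Sum>x\<in>triples_of_sum n. norm (t x)) summable_on UNIV"
    using assms by (intro norm_summable_imp_summable_on) (simp add: sum_nonneg)
  hence "(\<lambda>x. norm (t (snd x))) summable_on Sigma UNIV triples_of_sum"
    by (subst Infinite_Sum.abs_summable_on_Sigma_iff) (auto simp: sum_nonneg)
  hence snd: "(\<lambda>x. t (snd x)) summable_on Sigma UNIV triples_of_sum" and abs: "(\<lambda>x. norm (t x)) summable_on UNIV"
    using summable_on_reindex_bij_betw[OF bij, of "\<lambda>x. norm (t x)"]
    by (auto intro: abs_summable_summable)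
  have "(\<lambda>n. \<Sum>x\<in>triples_of_sum n. t x) summable_on UNIV"
    using summable_on_Sigma_banach[of "\<lambda>n x. t x" UNIV triples_of_sum] snd
    by (simp add: case_prod_unfold)
  from has_sum_imp_sums[OF has_sum_infsum[OF this]]
  have "(\<lambda>n. \<Sum>x\<in>triples_of_sum n. t x) sums (\<Sum>\<^sub>\<infinity>n. \<Sum>x\<in>triples_of_sum n. t x)" .
  also have "(\<Sum>\<^sub>\<infinity>n. \<Sum>x\<in>triples_of_sum n. t x) = infsum (\<lambda>x. t (snd x)) (Sigma UNIV triples_of_sum)"
    using infsum_Sigma_banach[OF snd] by simp
  also have "\<dots> = infsum t UNIV"
    by (rule infsum_reindex_bij_betw[OF bij])
  also have "\<dots> = (\<Sum>\<^sub>\<infinity>l. \<Sum>\<^sub>\<infinity>q. t (l, q))"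
    using infsum_Sigma_banach[of t UNIV "\<lambda>_. UNIV"] abs_summable_summable[OF abs] by simp
  also have "\<dots> = (\<Sum>l. \<Sum>\<^sub>\<infinity>q. t (l, q))"
    using summable_on_Sigma_banach[of "\<lambda>l q. t (l, q)" UNIV "\<lambda>_. UNIV"] abs_summable_summable[OF abs]
    by (intro suminf_eq[symmetric]) simp
  also have "(\<lambda>l. \<Sum>\<^sub>\<infinity>q. t (l, q)) = (\<lambda>l. \<Sum>p. \<Sum>k. t (l, p, k))"
  proof
    fix l
    have "(\<lambda>q. norm (t (l, q))) summable_on UNIV"
      using abs Infinite_Sum.abs_summable_on_Sigma_iff[of t UNIV "\<lambda>_. UNIV"] by simp
    hence abs_l: "(\<lambda>x. norm ((\<lambda>(p, k). t (l, p, k)) x)) summable_on UNIV \<times> UNIV"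
      by (simp add: case_prod_unfold)
    have "(\<Sum>\<^sub>\<infinity>q. t (l, q)) = (\<Sum>\<^sub>\<infinity>p. \<Sum>\<^sub>\<infinity>k. t (l, p, k))"
      using infsum_Sigma_banach[OF abs_summable_summable[OF abs_l]] by (simp add: case_prod_unfold)
    also have "\<dots> = (\<Sum>p. \<Sum>\<^sub>\<infinity>k. t (l, p, k))"
      using summable_on_Sigma_banach[OF abs_summable_summable[OF abs_l]]
      by (intro suminf_eq[symmetric]) simp
    also have "(\<lambda>p. \<Sum>\<^sub>\<infinity>k. t (l, p, k)) = (\<lambda>p. \<Sum>k. t (l, p, k))"
    proof (intro ext suminf_eq[symmetric])
      fix p
      have "(\<lambda>k. norm (t (l, p, k))) summable_on UNIV"
        using abs_l Infinite_Sum.abs_summable_on_Sigma_iff[of "\<lambda>(p, k). t (l, p, k)" UNIV "\<lambda>_. UNIV"] by simp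
      thus "(\<lambda>k. t (l, p, k)) summable_on UNIV" by (rule abs_summable_summable)
    qed
    finally show "(\<Sum>\<^sub>\<infinity>q. t (l, q)) = (\<Sum>p. \<Sum>k. t (l, p, k))" .
  qed
  finally show ?thesis .
qed

section \<open>Growth of the reciprocal Gamma function\<close>

lemma powr_of_nat_mult:
  fixes z a :: complex
  assumes "z \<noteq> 0"
  shows "(z powr (- a)) ^ n = z powr (- (of_nat n * a))"
  using assms by (simp add: powr_def mult_ac flip: exp_of_nat_mult)

lemma eventually_powr_small:
  fixes a :: complex
  assumes "Re a > 0" "(A::real) > 0"
  shows "\<forall>\<^sub>F z in at_infinity. norm (z powr (- a)) < A"
  using tendsto_mult_powr_uminus[OF assms(1), of 1] assms(2) by (auto simp: tendsto_iff dist_norm)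

text \<open>\<open>A\<close> may be arbitrarily small: far from the origin all three powers have
  modulus below \<open>A\<close>, and Hankel's formula on a contour out there, with a monomial in
  these powers as the factor \<open>q\<close>, gives the estimate.\<close>

lemma rGamma_growth:
  fixes \<alpha> \<beta> \<gamma> \<delta> :: complex
  assumes "Re \<alpha> > 0" "Re \<beta> > 0" "Re \<gamma> > 0" and A: "A > 0"
  obtains L where "L \<ge> 0" and "\<And>l p k. norm (rGamma (of_nat l * \<alpha> + of_nat p * \<beta> + of_nat k * \<gamma> + \<delta>)) \<le> L * A ^ (l + p + k)"
proof -
  have "\<forall>\<^sub>F z in at_infinity. norm (z powr (- \<alpha>)) < A \<and> norm (z powr (- \<beta>)) < A \<and> norm (z powr (- \<gamma>)) < A"
    using assms by (intro eventually_conj eventually_powr_small)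
  then obtain R where R: "R > 0" "\<And>z. R \<le> norm z \<Longrightarrow>
      norm (z powr (- \<alpha>)) < A \<and> norm (z powr (- \<beta>)) < A \<and> norm (z powr (- \<gamma>)) < A"
    unfolding eventually_at_infinity_pos by blast
  \<comment> \<open>The extra \<open>1\<close> provides the strict inequality that
    \<open>hankel_integral_bound\<close> asks for.\<close>
  obtain H where H: "hankel_contour H" "\<And>t. R + 1 \<le> norm (H t)"
    using hankel_contour_exists[of "R + 1"] R(1) by auto
  have R_less: "R < norm (H t)" for t using H(2)[of t] by simp
  obtain L where L: "L \<ge> 0" "\<And>q B I. q holomorphic_on (- \<real>\<^sub>\<le>\<^sub>0) \<Longrightarrow>
      (\<And>z. z \<notin> \<real>\<^sub>\<le>\<^sub>0 \<Longrightarrow> R \<le> norm z \<Longrightarrow> norm (q z) \<le> B) \<Longrightarrow>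
      has_hankel_integral (\<lambda>z. exp z * z powr (- \<delta>) * q z) I H \<Longrightarrow> norm I \<le> L * B"
    using hankel_integral_bound[OF H(1) R_less, of "- \<delta>"] by blast
  have "norm (rGamma (of_nat l * \<alpha> + of_nat p * \<beta> + of_nat k * \<gamma> + \<delta>)) \<le> L / (2 * pi) * A ^ (l + p + k)" for l p k
  proof -
    let ?s = "of_nat l * \<alpha> + of_nat p * \<beta> + of_nat k * \<gamma> + \<delta>"
    define q where "q = (\<lambda>z::complex. (z powr (- \<alpha>)) ^ l * (z powr (- \<beta>)) ^ p * (z powr (- \<gamma>)) ^ k)"
    have "exp z * z powr (- ?s) = exp z * z powr (- \<delta>) * q z" for z
    proof (cases "z = 0")
      case False
      have "- ?s = - (of_nat l * \<alpha>) + (- (of_nat p * \<beta>) + (- (of_nat k * \<gamma>) + - \<delta>))" by simp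
      thus ?thesis using False by (simp only: q_def powr_of_nat_mult[OF False] powr_add mult_ac)
    qed auto
    hence "has_hankel_integral (\<lambda>z. exp z * z powr (- \<delta>) * q z) (2 * of_real pi * \<i> * rGamma ?s) H"
      using has_hankel_integral_rGamma[OF H(1), of ?s] by (simp only:)
    moreover have "q holomorphic_on (- \<real>\<^sub>\<le>\<^sub>0)"
      unfolding q_def by (auto intro!: holomorphic_intros)
    moreover have "norm (q z) \<le> A ^ (l + p + k)" if "R \<le> norm z" for z
      using R(2)[OF that] A unfolding q_def norm_mult norm_power power_add
      by (intro mult_mono power_mono) auto
    ultimately have "norm (2 * of_real pi * \<i> * rGamma ?s) \<le> L * A ^ (l + p + k)"
      by (intro L(2)) auto
    hence "norm (rGamma ?s) * (2 * pi) \<le> L * A ^ (l + p + k)"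
      by (simp add: norm_mult mult_ac)
    thus ?thesis by (simp add: field_simps)
  qed
  moreover have "L / (2 * pi) \<ge> 0" using L(1) by simp
  ultimately show ?thesis using that by blast
qed

text \<open>This is the binomial series with exponent \<open>- \<eta>\<close> at \<open>- z\<close>;
  the sign of the binomial coefficient cancels the sign of the power.\<close>

lemma pochhammer_binomial_sums:
  fixes \<eta> z :: complex
  assumes "norm z < 1"
  shows "(\<lambda>n. pochhammer \<eta> n / fact n * z ^ n) sums (1 - z) powr (- \<eta>)"
proof -
  have "((- \<eta>) gchoose n) * (- z) ^ n = pochhammer \<eta> n / fact n * z ^ n" for n
  proof -
    have "((- \<eta>) gchoose n) * (- z) ^ n =
            ((- 1) ^ n * (- 1) ^ n) * (pochhammer \<eta> n / fact n * z ^ n)"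
      by (simp only: gbinomial_pochhammer power_minus[of z n] minus_minus
            times_divide_eq_left times_divide_eq_right mult_ac)
    also have "(- 1) ^ n * (- 1) ^ n = (1 :: complex)"
      by (simp flip: power_mult_distrib)
    finally show ?thesis by simp
  qed
  thus ?thesis using gen_binomial_complex[of "- z" "- \<eta>"] assms by simp
qed

text \<open>Convergence at a point strictly between \<open>r\<close> and \<open>1\<close> forces
  absolute convergence at \<open>r\<close>.\<close>

lemma summable_norm_pochhammer_binomial:
  fixes \<eta> :: complex
  assumes "0 \<le> r" "r < 1"
  shows "summable (\<lambda>n. norm (pochhammer \<eta> n / fact n) * r ^ n)"
proof -
  define x where "x = (1 + r) / 2"
  have x: "0 \<le> x" "r < x" "x < 1" using assms by (auto simp: x_def)
  have "summable (\<lambda>n. pochhammer \<eta> n / fact n * of_real x ^ n)"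
    using x by (intro sums_summable[OF pochhammer_binomial_sums]) simp
  from powser_insidea[OF this, of "of_real r"] show ?thesis
    using assms x by (simp add: norm_mult norm_power norm_divide)
qed

text \<open>The decay of \<open>rGamma\<close> scales each variable by \<open>A\<close>. The
  trinomial formula then bounds the moduli on a diagonal by a multiple of a term of the binomial
  series at \<open>1 / 2\<close>, which gives absolute convergence.\<close>

lemma mittag_leffler3_diagonal_sums:
  fixes \<alpha> \<beta> \<gamma> \<delta> \<eta> u v w :: complex
  assumes "Re \<alpha> > 0" "Re \<beta> > 0" "Re \<gamma> > 0"
  shows "(\<lambda>n. \<Sum>(l, p, k)\<in>triples_of_sum n. pochhammer \<eta> (l + p + k)
              * rGamma (of_nat l * \<alpha> + of_nat p * \<beta> + of_nat k * \<gamma> + \<delta>)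
              * (u ^ l * v ^ p * w ^ k / (fact l * fact p * fact k)))
           sums mittag_leffler3 \<alpha> \<beta> \<gamma> \<delta> \<eta> u v w"
proof -
  define t where "t = (\<lambda>(l, p, k). pochhammer \<eta> (l + p + k)
              * rGamma (of_nat l * \<alpha> + of_nat p * \<beta> + of_nat k * \<gamma> + \<delta>)
              * (u ^ l * v ^ p * w ^ k / (fact l * fact p * fact k)))"
  define m where "m = norm u + norm v + norm w"
  \<comment> \<open>Chosen so that \<open>m * A \<le> 1 / 2\<close>; the \<open>+ 1\<close> keeps
    the denominator positive when \<open>u\<close>, \<open>v\<close> and \<open>w\<close> all
    vanish.\<close>
  define A where "A = 1 / (2 * (m + 1))"
  have m: "m \<ge> 0" by (simp add: m_def)
  have A: "A > 0" "m * A \<le> 1 / 2" using m by (auto simp: A_def field_simps)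
  obtain L where L: "L \<ge> 0" "\<And>l p k. norm (rGamma (of_nat l * \<alpha> + of_nat p * \<beta> + of_nat k * \<gamma> + \<delta>)) \<le> L * A ^ (l + p + k)"
    using rGamma_growth[OF assms A(1)] by blast
  have "summable (\<lambda>n. \<Sum>x\<in>triples_of_sum n. norm (t x))"
  proof (rule summable_comparison_test_ev)
    show "summable (\<lambda>n. L * (norm (pochhammer \<eta> n / fact n) * (1 / 2) ^ n))"
      by (intro summable_mult summable_norm_pochhammer_binomial) auto
    have "norm (\<Sum>x\<in>triples_of_sum n. norm (t x)) \<le> L * (norm (pochhammer \<eta> n / fact n) * (1 / 2) ^ n)" for n
    proof -
      let ?c = "\<lambda>l p k. (norm u * A) ^ l * (norm v * A) ^ p * (norm w * A) ^ k / (fact l * fact p * fact k)"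
      have "norm (\<Sum>x\<in>triples_of_sum n. norm (t x)) = (\<Sum>x\<in>triples_of_sum n. norm (t x))"
        by (simp add: sum_nonneg)
      also have "\<dots> \<le> (\<Sum>(l, p, k)\<in>triples_of_sum n. L * norm (pochhammer \<eta> n) * ?c l p k)"
      proof (rule sum_mono, clarify)
        fix l p k assume "(l, p, k) \<in> triples_of_sum n"
        hence n: "l + p + k = n" by (simp add: triples_of_sum_def)
        let ?d = "norm (u ^ l * v ^ p * w ^ k / (fact l * fact p * fact k))"
        have "norm (t (l, p, k)) \<le> norm (pochhammer \<eta> n) * (L * A ^ (l + p + k)) * ?d"
          unfolding t_def case_prod_conv norm_mult n using L(2)[of l p k, unfolded n]
          by (intro mult_right_mono mult_left_mono) auto
        also have "?d = norm u ^ l * norm v ^ p * norm w ^ k / (fact l * fact p * fact k)"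
          by (simp add: norm_mult norm_power norm_divide)
        finally show "norm (t (l, p, k)) \<le> L * norm (pochhammer \<eta> n) * ?c l p k"
          by (simp add: power_mult_distrib power_add mult_ac)
      qed
      also have "\<dots> = L * norm (pochhammer \<eta> n) * (\<Sum>(l, p, k)\<in>triples_of_sum n. ?c l p k)"
        by (simp add: sum_distrib_left case_prod_unfold)
      also have "\<dots> = L * norm (pochhammer \<eta> n) * ((m * A) ^ n / fact n)"
        by (subst trinomial_exponential_form[symmetric]) (simp add: m_def distrib_right)
      also have "\<dots> \<le> L * norm (pochhammer \<eta> n) * ((1 / 2) ^ n / fact n)"
        using L(1) A m by (intro mult_left_mono divide_right_mono power_mono) auto
      finally show ?thesis by (simp add: norm_divide mult_ac)
    qed
    thus "\<forall>\<^sub>F n in sequentially. norm (\<Sum>x\<in>triples_of_sum n. norm (t x)) \<le>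
            L * (norm (pochhammer \<eta> n / fact n) * (1 / 2) ^ n)" by simp
  qed
  from sums_suminf_iterated[OF this] show ?thesis
    by (simp add: t_def mittag_leffler3_def)
qed

section \<open>Termwise integration along the given contour\<close>

theorem theorem2p1:
  fixes \<alpha> \<beta> \<gamma> \<delta> \<eta> u v w :: complex and H :: "real \<Rightarrow> complex"
  assumes "Re \<alpha> > 0" and "Re \<beta> > 0" and "Re \<gamma> > 0"
    and "hankel_contour H"
    and "\<And>t. norm (u * H t powr (- \<alpha>) + v * H t powr (- \<beta>) + w * H t powr (- \<gamma>)) < 1"
  shows "let f = (\<lambda>\<tau>. exp \<tau> * \<tau> powr (- \<delta>)
               / (1 - u * \<tau> powr (- \<alpha>) - v * \<tau> powr (- \<beta>) - w * \<tau> powr (- \<gamma>)) powr \<eta>)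
         in hankel_integrable f H \<and>
            mittag_leffler3 \<alpha> \<beta> \<gamma> \<delta> \<eta> u v w = 1 / (2 * of_real pi * \<i>) * hankel_integral H f"
proof -
  define S where "S = (\<lambda>z. u * z powr (- \<alpha>) + v * z powr (- \<beta>) + w * z powr (- \<gamma>))"
  define e where "e = (\<lambda>z. exp z * z powr (- \<delta>))"
  define b where "b = (\<lambda>n. pochhammer \<eta> n / fact n)"
  define g where "g = (\<lambda>n z. e z * (b n * S z ^ n))"
  define f where "f = (\<lambda>z. e z / (1 - S z) powr \<eta>)"
  define t where "t = (\<lambda>(l, p, k). pochhammer \<eta> (l + p + k)
              * rGamma (of_nat l * \<alpha> + of_nat p * \<beta> + of_nat k * \<gamma> + \<delta>)
              * (u ^ l * v ^ p * w ^ k / (fact l * fact p * fact k)))"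
  define I where "I = (\<lambda>n. \<Sum>x\<in>triples_of_sum n. 2 * of_real pi * \<i> * t x)"
  define J where "J = 2 * of_real pi * \<i> * mittag_leffler3 \<alpha> \<beta> \<gamma> \<delta> \<eta> u v w"
  have S_hol: "S holomorphic_on (- \<real>\<^sub>\<le>\<^sub>0)" and e_hol: "e holomorphic_on (- \<real>\<^sub>\<le>\<^sub>0)"
    unfolding S_def e_def by (auto intro!: holomorphic_intros)
  have g_hol: "g n holomorphic_on (- \<real>\<^sub>\<le>\<^sub>0)" for n
    unfolding g_def by (intro holomorphic_intros S_hol e_hol)
  have f_sums: "(\<lambda>n. g n z) sums f z" if "norm (S z) < 1" for z
    using sums_mult[OF pochhammer_binomial_sums[OF that, of \<eta>], of "e z"]
    by (simp add: g_def f_def b_def powr_minus divide_inverse)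

  \<comment> \<open>The trinomial expansion splits the \<open>n\<close>-th binomial term into
    finitely many Hankel integrands, whose values make up the \<open>n\<close>-th diagonal.\<close>
  have g_integral: "has_hankel_integral (g n) (I n) H" for n
  proof -
    have "g n z = (\<Sum>(l, p, k)\<in>triples_of_sum n. pochhammer \<eta> (l + p + k) * (u ^ l * v ^ p * w ^ k / (fact l * fact p * fact k))
              * (exp z * z powr (- (of_nat l * \<alpha> + of_nat p * \<beta> + of_nat k * \<gamma> + \<delta>))))" for z
    \<comment> \<open>At \<open>0\<close> both sides vanish since \<open>0 powr a = 0\<close> for
      every \<open>a\<close>; elsewhere the exponents add up.\<close>
    proof (cases "z = 0")
      case True
      thus ?thesis by (simp add: g_def e_def)
    next
      case False
      have "g n z = (e z * pochhammer \<eta> n) * (S z ^ n / fact n)" by (simp add: g_def b_def)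
      also have "\<dots> = (\<Sum>(l, p, k)\<in>triples_of_sum n. e z * pochhammer \<eta> n *
          ((u * z powr (- \<alpha>)) ^ l * (v * z powr (- \<beta>)) ^ p * (w * z powr (- \<gamma>)) ^ k / (fact l * fact p * fact k)))"
        by (simp only: S_def trinomial_exponential_form sum_distrib_left case_prod_unfold)
      also have "\<dots> = (\<Sum>(l, p, k)\<in>triples_of_sum n. pochhammer \<eta> (l + p + k) * (u ^ l * v ^ p * w ^ k / (fact l * fact p * fact k))
              * (exp z * z powr (- (of_nat l * \<alpha> + of_nat p * \<beta> + of_nat k * \<gamma> + \<delta>))))"
      proof (rule sum.cong[OF refl], clarify)
        fix l p k assume "(l, p, k) \<in> triples_of_sum n"
        hence n: "l + p + k = n" by (simp add: triples_of_sum_def)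
        have "- (of_nat l * \<alpha> + of_nat p * \<beta> + of_nat k * \<gamma> + \<delta>) =
            - (of_nat l * \<alpha>) + (- (of_nat p * \<beta>) + (- (of_nat k * \<gamma>) + - \<delta>))" by simp
        hence powr_eq: "z powr (- (of_nat l * \<alpha> + of_nat p * \<beta> + of_nat k * \<gamma> + \<delta>)) =
            (z powr (- \<alpha>)) ^ l * ((z powr (- \<beta>)) ^ p * ((z powr (- \<gamma>)) ^ k * z powr (- \<delta>)))"
          by (simp only: powr_add powr_of_nat_mult[OF False])
        show "e z * pochhammer \<eta> n *
          ((u * z powr (- \<alpha>)) ^ l * (v * z powr (- \<beta>)) ^ p * (w * z powr (- \<gamma>)) ^ k / (fact l * fact p * fact k)) =
          pochhammer \<eta> (l + p + k) * (u ^ l * v ^ p * w ^ k / (fact l * fact p * fact k))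
              * (exp z * z powr (- (of_nat l * \<alpha> + of_nat p * \<beta> + of_nat k * \<gamma> + \<delta>)))"
          unfolding powr_eq n e_def by (simp only: power_mult_distrib times_divide_eq_left times_divide_eq_right mult_ac)
      qed
      finally show ?thesis .
    qed
    moreover have "has_hankel_integral (\<lambda>z. \<Sum>x\<in>triples_of_sum n. case x of (l, p, k) \<Rightarrow>
        pochhammer \<eta> (l + p + k) * (u ^ l * v ^ p * w ^ k / (fact l * fact p * fact k))
              * (exp z * z powr (- (of_nat l * \<alpha> + of_nat p * \<beta> + of_nat k * \<gamma> + \<delta>)))) (I n) H"
      unfolding I_def
    proof (rule has_hankel_integral_sum[OF finite_triples_of_sum])
      fix x assume "x \<in> triples_of_sum n"
      obtain l p k where x: "x = (l, p, k)" by (cases x)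
      show "has_hankel_integral (\<lambda>z. case x of (l, p, k) \<Rightarrow>
        pochhammer \<eta> (l + p + k) * (u ^ l * v ^ p * w ^ k / (fact l * fact p * fact k))
              * (exp z * z powr (- (of_nat l * \<alpha> + of_nat p * \<beta> + of_nat k * \<gamma> + \<delta>)))) (2 * of_real pi * \<i> * t x) H"
        using has_hankel_integral_cmult[OF has_hankel_integral_rGamma[OF assms(4)],
            of "pochhammer \<eta> (l + p + k) * (u ^ l * v ^ p * w ^ k / (fact l * fact p * fact k))"
               "of_nat l * \<alpha> + of_nat p * \<beta> + of_nat k * \<gamma> + \<delta>"]
        by (simp add: x t_def mult_ac)
    qed
    ultimately show ?thesis by presburger
  qed

  have I_sums: "I sums J"
    using sums_mult[OF mittag_leffler3_diagonal_sums[OF assms(1-3), of \<eta> \<delta> u v w], of "2 * of_real pi * \<i>"]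
    by (simp add: I_def J_def t_def sum_distrib_left case_prod_unfold)

  have pieces: "f contour_integrable_on (H \<circ> linepath x y) \<and>
      (\<lambda>n. contour_integral (H \<circ> linepath x y) (g n)) sums contour_integral (H \<circ> linepath x y) f" for x y
  proof -
    let ?h = "H \<circ> linepath x y"
    have h: "valid_path ?h" "path_image ?h \<subseteq> - \<real>\<^sub>\<le>\<^sub>0"
      using assms(4) unfolding hankel_contour_def path_image_comp_linepath by auto
    obtain M where M: "M > 0" "\<And>z. z \<in> path_image ?h \<Longrightarrow> norm (e z) < M"
      using contour_image_bounded[OF h holomorphic_on_imp_continuous_on[OF e_hol]] by blast
    \<comment> \<open>The modulus of \<open>S\<close> attains its maximum on the compact path, so it
      stays away from \<open>1\<close>; a strictly larger \<open>r\<close> leaves room for an open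
      neighbourhood.\<close>
    obtain r where r: "0 \<le> r" "r < 1" "\<And>z. z \<in> path_image ?h \<Longrightarrow> norm (S z) < r"
    proof -
      have "compact (path_image ?h)" "path_image ?h \<noteq> {}"
        using h(1) by (auto intro: compact_valid_path_image)
      moreover have "continuous_on (path_image ?h) (\<lambda>z. norm (S z))"
        using h(2) holomorphic_on_imp_continuous_on[OF S_hol]
        by (intro continuous_intros) (auto intro: continuous_on_subset)
      ultimately obtain z0 where z0: "z0 \<in> path_image ?h" "\<And>z. z \<in> path_image ?h \<Longrightarrow> norm (S z) \<le> norm (S z0)"
        using continuous_attains_sup[of "path_image ?h" "\<lambda>z. norm (S z)"] by blast
      have "norm (S z0) < 1"
        using z0(1) assms(5) unfolding path_image_comp_linepath S_def by auto
      then obtain r where r: "norm (S z0) < r" "r < 1" using dense by blast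
      hence "0 \<le> r" using norm_ge_zero[of "S z0"] by linarith
      thus ?thesis using r z0(2) by (intro that[of r]) (auto intro: le_less_trans)
    qed
    \<comment> \<open>On this open neighbourhood of the piece the binomial series converges
      uniformly, with majorant \<open>M * (norm (b n) * r ^ n)\<close>.\<close>
    define T where "T = {z. z \<notin> \<real>\<^sub>\<le>\<^sub>0 \<and> norm (e z) < M} \<inter> {z. z \<notin> \<real>\<^sub>\<le>\<^sub>0 \<and> norm (S z) < r}"
    have T: "open T" "path_image ?h \<subseteq> T"
      unfolding T_def using M(2) r(3) h(2)
      by (auto intro!: open_slit_plane_preimage holomorphic_on_imp_continuous_on e_hol S_hol)
    have T_slit: "T \<subseteq> - \<real>\<^sub>\<le>\<^sub>0" by (auto simp: T_def)
    have f_hol: "f holomorphic_on T"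
      unfolding f_def
    proof (intro holomorphic_intros)
      show "e holomorphic_on T" "S holomorphic_on T"
        using e_hol S_hol T_slit by (auto intro: holomorphic_on_subset)
      fix z assume "z \<in> T"
      hence "norm (S z) < 1" using r by (auto simp: T_def)
      \<comment> \<open>This keeps \<open>1 - S z\<close> in the open right half-plane, away from
        the branch cut of the power.\<close>
      hence "Re (S z) < 1" using complex_Re_le_cmod[of "S z"] by linarith
      thus "1 - S z \<notin> \<real>\<^sub>\<le>\<^sub>0" "(1 - S z) powr \<eta> \<noteq> 0" by (auto simp: complex_nonpos_Reals_iff)
    qed
    have gT: "g n holomorphic_on T" for n using g_hol T_slit by (rule holomorphic_on_subset)
    have f_int: "f contour_integrable_on ?h" and g_int: "g n contour_integrable_on ?h" for n
      using contour_integrable_holomorphic_simple[OF _ T(1) h(1) T(2)] f_hol gT by auto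
    obtain L where L: "L > 0" "\<And>q B. q holomorphic_on T \<Longrightarrow> (\<And>z. z \<in> T \<Longrightarrow> norm (q z) \<le> B) \<Longrightarrow>
        norm (contour_integral ?h q) \<le> L * B"
      using contour_integral_bound_exists[OF T(1) h(1) T(2)] by metis
    have b_summable: "summable (\<lambda>n. norm (b n) * r ^ n)"
      using summable_norm_pochhammer_binomial[of r \<eta>] r by (simp add: b_def)
    \<comment> \<open>The remainder of the majorant series, which controls the partial sums
      uniformly on \<open>T\<close>.\<close>
    define \<epsilon> where "\<epsilon> = (\<lambda>N. \<Sum>n. norm (b (n + N)) * r ^ (n + N))"
    have "\<epsilon> \<longlonglongrightarrow> 0"
      unfolding \<epsilon>_def using suminf_exist_split2[OF b_summable] .
    hence \<epsilon>: "(\<lambda>N. L * (M * \<epsilon> N)) \<longlonglongrightarrow> 0" by (intro tendsto_mult_right_zero)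
    have "norm ((\<Sum>n<N. contour_integral ?h (g n)) - contour_integral ?h f) \<le> L * (M * \<epsilon> N)" for N
    proof -
      have "contour_integral ?h (\<lambda>z. (\<Sum>n<N. g n z) - f z) =
          (\<Sum>n<N. contour_integral ?h (g n)) - contour_integral ?h f"
        using f_int g_int by (simp add: contour_integral_diff contour_integral_sum contour_integrable_sum)
      moreover have "norm (contour_integral ?h (\<lambda>z. (\<Sum>n<N. g n z) - f z)) \<le> L * (M * \<epsilon> N)"
      proof (rule L(2))
        show "(\<lambda>z. (\<Sum>n<N. g n z) - f z) holomorphic_on T"
          by (intro holomorphic_intros f_hol gT)
        fix z assume z: "z \<in> T"
        have zr: "norm (S z) < r" "norm (e z) < M" using z by (auto simp: T_def)
        have "norm (S z) < 1" using zr r by simp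
        from f_sums[OF this] have "(\<lambda>n. g (n + N) z) sums (f z - (\<Sum>n<N. g n z))"
          using sums_iff_shift[of "\<lambda>n. g n z" N] by simp
        hence "norm ((\<Sum>n<N. g n z) - f z) = norm (\<Sum>n. g (n + N) z)"
          by (simp add: sums_iff norm_minus_commute)
        also have "\<dots> \<le> (\<Sum>n. M * (norm (b (n + N)) * r ^ (n + N)))"
        proof (rule norm_suminf_le)
          show "summable (\<lambda>n. M * (norm (b (n + N)) * r ^ (n + N)))"
            using summable_ignore_initial_segment[OF b_summable, of N] by (rule summable_mult)
          show "norm (g (n + N) z) \<le> M * (norm (b (n + N)) * r ^ (n + N))" for n
            unfolding g_def norm_mult norm_power using zr r M(1)
            by (intro mult_mono mult_left_mono power_mono) auto
        qed
        also have "\<dots> = M * \<epsilon> N"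
          unfolding \<epsilon>_def using summable_ignore_initial_segment[OF b_summable, of N]
          by (rule suminf_mult)
        finally show "norm ((\<Sum>n<N. g n z) - f z) \<le> M * \<epsilon> N" .
      qed
      ultimately show ?thesis by simp
    qed
    hence "(\<lambda>N. (\<Sum>n<N. contour_integral ?h (g n)) - contour_integral ?h f) \<longlonglongrightarrow> 0"
      by (intro Lim_null_comparison[OF _ \<epsilon>]) auto
    thus ?thesis using f_int by (simp add: sums_def LIM_zero_iff)
  qed

  \<comment> \<open>Since \<open>S\<close> tends to \<open>0\<close> at infinity, deep in a tail the
    majorant is the binomial series at \<open>1 / 2\<close>, even at points off the contour, about
    which the hypothesis on \<open>H\<close> says nothing.\<close>
  have tails: "\<exists>X K. 0 \<le> X \<and> summable K \<and>
      (\<forall>n \<sigma> z. \<bar>\<sigma>\<bar> = 1 \<longrightarrow> z \<in> hankel_tail \<sigma> c X \<longrightarrow> norm (g n z) \<le> K n * exp (Re z / 2))"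
    if c: "c > 0" for c
  proof -
    have "(S \<longlongrightarrow> 0 + 0 + 0) at_infinity"
      unfolding S_def using assms(1-3) by (intro tendsto_add tendsto_mult_powr_uminus)
    from tendstoD[OF this, of "1 / 2"] have "\<forall>\<^sub>F z in at_infinity. norm (S z) < 1 / 2"
      by (simp add: dist_norm)
    then obtain R where R: "\<And>z. R \<le> norm z \<Longrightarrow> norm (S z) < 1 / 2"
      unfolding eventually_at_infinity by blast
    obtain K where K: "K \<ge> 0" "\<And>\<sigma> z. \<bar>\<sigma>\<bar> = 1 \<Longrightarrow> z \<in> hankel_tail \<sigma> c 1 \<Longrightarrow>
        norm (e z) \<le> K * exp (Re z / 2)"
      unfolding e_def by (rule exp_mult_powr_hankel_tail_bound[OF c, of "- \<delta>"]) simp_all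
    define X where "X = max 1 R"
    have "norm (g n z) \<le> K * (norm (b n) * (1 / 2) ^ n) * exp (Re z / 2)"
      if \<sigma>: "\<bar>\<sigma>\<bar> = 1" and z: "z \<in> hankel_tail \<sigma> c X" for n \<sigma> z
    proof -
      have "norm (e z) \<le> K * exp (Re z / 2)"
        using hankel_tail_mono[of 1 X \<sigma> c] z by (intro K(2)[OF \<sigma>]) (auto simp: X_def)
      moreover have "R \<le> norm z"
        using z abs_Re_le_cmod[of z] by (auto simp: hankel_tail_def X_def)
      hence "norm (S z) ^ n \<le> (1 / 2) ^ n" using R by (intro power_mono) (auto intro: less_imp_le)
      ultimately have "norm (e z) * (norm (b n) * norm (S z) ^ n) \<le>
          K * exp (Re z / 2) * (norm (b n) * (1 / 2) ^ n)"
        using K(1) by (intro mult_mono mult_left_mono) auto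
      thus ?thesis by (simp add: g_def norm_mult norm_power mult_ac)
    qed
    moreover have "summable (\<lambda>n. K * (norm (b n) * (1 / 2) ^ n))"
      unfolding b_def by (intro summable_mult summable_norm_pochhammer_binomial) auto
    moreover have "0 \<le> X" by (simp add: X_def)
    ultimately show ?thesis by blast
  qed

  have "has_hankel_integral f J H"
    by (rule has_hankel_integral_series[OF assms(4) g_integral _ _ g_hol tails I_sums]) (use pieces in auto)
  moreover have "f = (\<lambda>\<tau>. exp \<tau> * \<tau> powr (- \<delta>)
               / (1 - u * \<tau> powr (- \<alpha>) - v * \<tau> powr (- \<beta>) - w * \<tau> powr (- \<gamma>)) powr \<eta>)"
    by (simp add: f_def e_def S_def diff_diff_eq)
  ultimately show ?thesis
    by (auto simp: Let_def hankel_integrable_def hankel_integral_unique J_def)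
qed

end
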